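(* Let $P$ be a convex polygon in the plane, let $k\ge 1$, and let $\lambda_1,\dots,\lambda_k>0$ satisfy $\prod_{i=1}^k\lambda_i=1$. Let $T$ be the refractive outer billiard map about $P$ with refractive indices $\lambda_1,\dots,\lambda_k$. If $P$ is quasi-rational, then every orbit of $T$ is bounded; that is, for every strongly regular point $o$ the set $\{T^m(o): m\in\mathbb{Z}\}$ is a bounded subset of the plane.
   Context: Refractive outer billiards. $P$ is a (nondegenerate) convex polygon; the indices of $\lambda_i$ are read modulo $k$ (so $\lambda_0=\lambda_k$). For a point $B$ and $\lambda>0$ let $\rho_{B,\lambda}(z)=B+\lambda(B-z)$ (reflection about $B$ followed by scaling by $\lambda$ about $B$). For a point $z$ outside a convex polygon $Q$ and not on any line through a side of $Q$, there are two supporting rays from $z$ to $Q$: $L_+(z)$, with $Q$ lying to its right, and $L_-(z)$, with $Q$ lying to its left; each touches $Q$ at a single vertex. The contact vertex of $L_+(z)$ is the head of $Q$ about $z$, that of $L_-(z)$ is the tail of $Q$ about $z$. Starting from a point $o=T^0(o)$ outside $P$: for $m\ge 1$, $T^m(o)=\rho_{A_m,\lambda_m}(T^{m-1}(o))$, where $A_m$ is the head of $P$ about $T^{m-1}(o)$; for $m\le 0$, $T^{m-1}(o)=\rho_{A_m,1/\lambda_m}(T^m(o))$, where $A_m$ is the tail of $P$ about $T^m(o)$. A step is undefined when the current point lies on a line through a side of $P$. The point $o$ is strongly regular if $T^m(o)$ is defined for all $m\in\mathbb{Z}$ and none of these points lies on a line through a side of $P$. Orbits are considered for strongly regular points only.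 Cones and rays. Fix a base point, used as origin. Let $n$ be the number of distinct side directions of $P$. The $n$ lines through the origin parallel to the sides of $P$ form $2n$ rays $R_1,\dots,R_{2n}$ from the origin, labelled counterclockwise, indices mod $2n$; $C_j$ is the closed cone between $R_j$ and $R_{j+1}$. So $R_{n+j}=-R_j$, $C_{n+j}=-C_j$. Necklace vectors. $\vec a_j$ is the vector from the tail to the head, about the origin, of any polygon that is a translate of $P$ or of $-P$ and is contained in the interior of $C_j$; it does not depend on the polygon chosen. Equivalently, $\vec a_j=v_+-v_-$, where for any $u$ in the interior of $C_j$, with $u^\perp$ its counterclockwise rotation by $90^\circ$, $v_+$ (resp. $v_-$) is the vertex of $P$ maximizing (resp. minimizing) $\langle u^\perp,\cdot\rangle$. Necklace polygon and quasi-rationality. Choose $A_1\in R_1$ different from the origin; recursively let $A_{j+1}$ be the point where the ray from $A_j$ in direction $\vec a_j$ meets $R_{j+1}$. Then $\overrightarrow{A_jA_{j+1}}=r_j\vec a_j$ with $r_j>0$; the polygonal line closes up ($A_{2n+1}=A_1$) and $r_{n+j}=r_j$. (These points $A_j$ are unrelated to the contact points above; a different choice of $A_1$ multiplies all $r_j$ by a common factor.) $P$ is quasi-rational if $r_1,\dots,r_n$ are rational up to a common factor, i.e. there is $c>0$ with $cr_j\in\mathbb{Q}$ for $1\le j\le n$. *)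

theory Defs
  imports "HOL-Analysis.Analysis"
begin

definition convex_polygon :: "complex set \<Rightarrow> bool" where
  "convex_polygon P \<longleftrightarrow> polytope P \<and> interior P \<noteq> {}"

definition on_side_line :: "complex set \<Rightarrow> complex \<Rightarrow> bool" where
  "on_side_line P z \<longleftrightarrow> (\<exists>s. s edge_of P \<and> z \<in> affine hull s)"

definition halfline :: "complex \<Rightarrow> complex \<Rightarrow> complex set" where
  "halfline z u = {z + t *\<^sub>R u |t. t \<ge> 0}"

(* det (u, v); positive iff v points to the left of u *)
definition cross2 :: "complex \<Rightarrow> complex \<Rightarrow> real" where
  "cross2 u v = Re u * Im v - Im u * Re v"

(* The descriptions are meaningful for z outside Q and on no side line of Q. *)
definition head :: "complex set \<Rightarrow> complex \<Rightarrow> complex" where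
  "head Q z = (THE A. \<exists>u. u \<noteq> 0 \<and> halfline z u \<inter> Q = {A} \<and> (\<forall>p\<in>Q. cross2 u (p - z) \<le> 0))"

definition tail :: "complex set \<Rightarrow> complex \<Rightarrow> complex" where
  "tail Q z = (THE A. \<exists>u. u \<noteq> 0 \<and> halfline z u \<inter> Q = {A} \<and> (\<forall>p\<in>Q. cross2 u (p - z) \<ge> 0))"

definition refl_scale :: "complex \<Rightarrow> real \<Rightarrow> complex \<Rightarrow> complex" where
  "refl_scale B l z = B + l *\<^sub>R (B - z)"

(* The indices 1, ..., k extended k-periodically to all integers. *)
definition refr_index :: "nat \<Rightarrow> (nat \<Rightarrow> real) \<Rightarrow> int \<Rightarrow> real" where
  "refr_index k lam m = lam (nat ((m - 1) mod int k) + 1)"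

definition step_fwd :: "complex set \<Rightarrow> real \<Rightarrow> complex \<Rightarrow> complex option" where
  "step_fwd P l z =
     (if z \<notin> P \<and> \<not> on_side_line P z then Some (refl_scale (head P z) l z) else None)"

definition step_bwd :: "complex set \<Rightarrow> real \<Rightarrow> complex \<Rightarrow> complex option" where
  "step_bwd P l z =
     (if z \<notin> P \<and> \<not> on_side_line P z then Some (refl_scale (tail P z) (1 / l) z) else None)"

primrec iter_fwd :: "complex set \<Rightarrow> nat \<Rightarrow> (nat \<Rightarrow> real) \<Rightarrow> complex \<Rightarrow> nat \<Rightarrow> complex option" where
  "iter_fwd P k lam x 0 = Some x"
| "iter_fwd P k lam x (Suc i) =
     Option.bind (iter_fwd P k lam x i) (step_fwd P (refr_index k lam (int (Suc i))))"

primrec iter_bwd :: "complex set \<Rightarrow> nat \<Rightarrow> (nat \<Rightarrow> real) \<Rightarrow> complex \<Rightarrow> nat \<Rightarrow> complex option" where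
  "iter_bwd P k lam x 0 = Some x"
| "iter_bwd P k lam x (Suc i) =
     Option.bind (iter_bwd P k lam x i) (step_bwd P (refr_index k lam (- int i)))"

(* T^m(x); the value None means that T^m(x) is undefined. *)
definition billiard :: "complex set \<Rightarrow> nat \<Rightarrow> (nat \<Rightarrow> real) \<Rightarrow> int \<Rightarrow> complex \<Rightarrow> complex option" where
  "billiard P k lam m x =
     (if m \<ge> 0 then iter_fwd P k lam x (nat m) else iter_bwd P k lam x (nat (- m)))"

definition strongly_regular :: "complex set \<Rightarrow> nat \<Rightarrow> (nat \<Rightarrow> real) \<Rightarrow> complex \<Rightarrow> bool" where
  "strongly_regular P k lam x \<longleftrightarrow>
     x \<notin> P \<and> (\<forall>m. \<exists>z. billiard P k lam m x = Some z \<and> \<not> on_side_line P z)"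

definition billiard_orbit :: "complex set \<Rightarrow> nat \<Rightarrow> (nat \<Rightarrow> real) \<Rightarrow> complex \<Rightarrow> complex set" where
  "billiard_orbit P k lam x = {z. \<exists>m. billiard P k lam m x = Some z}"

definition side_lines :: "complex set \<Rightarrow> complex set set" where
  "side_lines P = {L. subspace L \<and> (\<exists>s. s edge_of P \<and> affine_parallel (affine hull s) L)}"

definition num_dirs :: "complex set \<Rightarrow> nat" where
  "num_dirs P = card (side_lines P)"

(* A counterclockwise labelling of the rays R_j, given by their angles: theta runs once
   around the circle while j runs through one period of length 2 n, n = num_dirs P. *)
definition ray_labelling :: "complex set \<Rightarrow> (nat \<Rightarrow> real) \<Rightarrow> bool" where
  "ray_labelling P \<theta> \<longleftrightarrow>
     strict_mono \<theta> \<and>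
     (\<forall>j. \<theta> (j + 2 * num_dirs P) = \<theta> j + 2 * pi) \<and>
     (\<Union>j\<in>{1..2 * num_dirs P}. halfline 0 (cis (\<theta> j))) = \<Union>(side_lines P)"

definition cone_between :: "(nat \<Rightarrow> real) \<Rightarrow> nat \<Rightarrow> complex set" where
  "cone_between \<theta> j = {t *\<^sub>R cis \<phi> |t \<phi>. t \<ge> 0 \<and> \<theta> j \<le> \<phi> \<and> \<phi> \<le> \<theta> (j + 1)}"

(* Well defined, since head Q 0 - tail Q 0 does not depend on Q. *)
definition necklace_vec :: "complex set \<Rightarrow> (nat \<Rightarrow> real) \<Rightarrow> nat \<Rightarrow> complex" where
  "necklace_vec P \<theta> j =
     (THE a. \<exists>Q t. (Q = (\<lambda>x. t + x) ` P \<or> Q = (\<lambda>x. t - x) ` P) \<and>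
                   Q \<subseteq> interior (cone_between \<theta> j) \<and> a = head Q 0 - tail Q 0)"

definition necklace_polygon ::
    "complex set \<Rightarrow> (nat \<Rightarrow> real) \<Rightarrow> (nat \<Rightarrow> complex) \<Rightarrow> (nat \<Rightarrow> real) \<Rightarrow> bool" where
  "necklace_polygon P \<theta> A r \<longleftrightarrow>
     A 1 \<in> halfline 0 (cis (\<theta> 1)) \<and> A 1 \<noteq> 0 \<and>
     (\<forall>j\<in>{1..2 * num_dirs P}.
        halfline (A j) (necklace_vec P \<theta> j) \<inter> halfline 0 (cis (\<theta> (j + 1))) = {A (j + 1)} \<and>
        r j > 0 \<and> A (j + 1) - A j = r j *\<^sub>R necklace_vec P \<theta> j)"

(* The choice of the first ray and of A 1 is immaterial: it only permutes the numbers
   r 1, ..., r n (n = num_dirs P) cyclically and rescales them by a common factor. *)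
definition quasi_rational :: "complex set \<Rightarrow> bool" where
  "quasi_rational P \<longleftrightarrow>
     (\<exists>\<theta> A r. ray_labelling P \<theta> \<and> necklace_polygon P \<theta> A r \<and>
        (\<exists>c>0. \<forall>j\<in>{1..num_dirs P}. c * r j \<in> \<rat>))"

end

theory Submission
  imports Defs
begin

text \<open>Move the polygon instead of the point: in the frame where the orbit point stays at the origin,
  the step replaces a copy of \<open>P\<close> by its rescaled reflection in its head, so that the copies form a chain
  in which each one touches the next. Their sizes are periodic, so the orbit is bounded iff the chain is.
  As long as the chain stays in the cone \<open>C\<^sub>j\<close>, its contact points move by multiples of the necklace vector \<open>a\<^sub>j\<close>.

  Scale the necklace polygon with vertices \<open>A\<^sub>j\<close> by a large \<open>M\<close> such that every side is an integer
  multiple of the displacement of the chain over a period; this is possible by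
  quasi-rationality. Continue the part of the chain in \<open>C\<^sub>j\<close> by \<open>a\<^sub>j\<close>-steps to a virtual bi-infinite chain, and ask whether it meets \<open>M A\<^sub>j + C\<^sub>j\<close>.
  By periodicity this is the same as meeting \<open>M A\<^sub>j\<^sub>+\<^sub>1 + C\<^sub>j\<close>. When the chain passes from \<open>C\<^sub>j\<close> to
  \<open>C\<^sub>j\<^sub>+\<^sub>1\<close>, it is also the same as the crossing polygon meeting the ray \<open>M A\<^sub>j\<^sub>+\<^sub>1 + R\<^sub>j\<^sub>+\<^sub>1\<close>, and hence as the virtual
  chain of \<open>C\<^sub>j\<^sub>+\<^sub>1\<close> meeting \<open>M A\<^sub>j\<^sub>+\<^sub>1 + C\<^sub>j\<^sub>+\<^sub>1\<close>. The answer is therefore invariant along the orbit.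
  If it is yes, the chain is far from the origin, and if it is no, it is near.\<close>

section \<open>Supporting vertices of a convex polygon\<close>

lemma cross2_add_left: "cross2 (a + b) c = cross2 a c + cross2 b c"
  and cross2_add_right: "cross2 a (b + c) = cross2 a b + cross2 a c"
  and cross2_diff_left: "cross2 (a - b) c = cross2 a c - cross2 b c"
  and cross2_diff_right: "cross2 a (b - c) = cross2 a b - cross2 a c"
  and cross2_scaleR_left [simp]: "cross2 (t *\<^sub>R a) c = t * cross2 a c"
  and cross2_scaleR_right [simp]: "cross2 a (t *\<^sub>R c) = t * cross2 a c"
  and cross2_minus_left [simp]: "cross2 (- a) c = - cross2 a c"
  and cross2_minus_right [simp]: "cross2 a (- c) = - cross2 a c"
  by (auto simp: cross2_def algebra_simps)

lemmas cross2_linear = cross2_add_left cross2_add_right cross2_diff_left cross2_diff_right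

lemma cross2_self [simp]: "cross2 a a = 0"
  and cross2_zero_left [simp]: "cross2 0 a = 0"
  and cross2_zero_right [simp]: "cross2 a 0 = 0"
  by (auto simp: cross2_def)

lemma cross2_swap: "cross2 b a = - cross2 a b"
  by (simp add: cross2_def)

lemma cross2_eq_inner: "cross2 u x = inner (\<i> * u) x"
  by (simp add: cross2_def inner_complex_def)

lemma cross2_cis: "cross2 (cis a) (cis b) = sin (b - a)"
  by (simp add: cross2_def sin_diff)

lemma cross2_bound: "\<bar>cross2 u x\<bar> \<le> norm u * norm x"
  unfolding cross2_eq_inner by (metis Cauchy_Schwarz_ineq2 norm_mult norm_ii mult_1)

text \<open>Cramer's rule in the plane, with the denominator cleared.\<close>

lemma cross2_expand: "cross2 u v *\<^sub>R x = cross2 x v *\<^sub>R u + cross2 u x *\<^sub>R v"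
  by (simp add: cross2_def complex_eq_iff algebra_simps)

lemma cross2_zero_imp_scaleR:
  assumes "cross2 u x = 0" "u \<noteq> 0"
  obtains t where "x = t *\<^sub>R u"
proof -
  have "(Re u ^ 2 + Im u ^ 2) *\<^sub>R x = inner u x *\<^sub>R u"
    using assms(1) by (simp add: cross2_def complex_eq_iff inner_complex_def algebra_simps power2_eq_square)
  moreover have "Re u ^ 2 + Im u ^ 2 \<noteq> 0"
    using assms(2) complex_neq_0[of u] by linarith
  ultimately have "x = (inner u x / (Re u ^ 2 + Im u ^ 2)) *\<^sub>R u"
    by (smt (verit, ccfv_threshold) scaleR_scaleR divide_inverse mult.commute right_inverse scaleR_one)
  then show thesis using that by blast
qed

lemma continuous_cross2 [continuous_intros]: "continuous_on X (\<lambda>x. cross2 u x)"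
  unfolding cross2_eq_inner by (intro continuous_intros)

text \<open>The support function of \<open>P\<close> in the direction \<open>\<i> * u\<close>, that
  is, \<open>u\<close> turned counterclockwise by a right angle.\<close>

definition sup_cross :: "complex set \<Rightarrow> complex \<Rightarrow> real" where
  "sup_cross P u = Sup (cross2 u ` P)"

text \<open>The extent of \<open>P\<close> across the lines parallel to \<open>u\<close>, multiplied
  by \<open>norm u\<close>.\<close>

definition wid :: "complex set \<Rightarrow> complex \<Rightarrow> real" where
  "wid P u = sup_cross P u + sup_cross P (- u)"

lemma wid_minus [simp]: "wid P (- u) = wid P u"
  by (simp add: wid_def)

definition maximizes :: "complex set \<Rightarrow> complex \<Rightarrow> complex \<Rightarrow> bool" where
  "maximizes P u v \<longleftrightarrow> v \<in> P \<and> (\<forall>p\<in>P. cross2 u p \<le> cross2 u v)"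

lemma maximizes_sup_cross: "maximizes P u v \<Longrightarrow> sup_cross P u = cross2 u v"
  unfolding sup_cross_def maximizes_def by (intro cSup_eq_maximum) auto

definition side_dirs :: "complex set \<Rightarrow> complex set" where
  "side_dirs P = \<Union>(side_lines P)"

lemma side_dirs_scaleR: "x \<in> side_dirs P \<Longrightarrow> t *\<^sub>R x \<in> side_dirs P"
  unfolding side_dirs_def side_lines_def by (auto intro: subspace_scale)

lemma side_dirs_minus: "- x \<in> side_dirs P \<longleftrightarrow> x \<in> side_dirs P"
  using side_dirs_scaleR[of x P "-1"] side_dirs_scaleR[of "-x" P "-1"] by auto

text \<open>A cone that turns counterclockwise from \<open>u\<close> to \<open>u'\<close> through
  less than a half turn, with no side direction in its interior. All directions of such a cone share
  their extremal vertices.\<close>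

definition good_pair :: "complex set \<Rightarrow> complex \<Rightarrow> complex \<Rightarrow> bool" where
  "good_pair P u u' \<longleftrightarrow> cross2 u u' > 0 \<and>
     (\<forall>s t. s > 0 \<and> t > 0 \<longrightarrow> s *\<^sub>R u + t *\<^sub>R u' \<notin> side_dirs P)"

lemma good_pair_minus: "good_pair P u u' \<Longrightarrow> good_pair P (- u) (- u')"
  unfolding good_pair_def
  by (metis (no_types, opaque_lifting) cross2_minus_left cross2_minus_right minus_add_distrib minus_minus
      scaleR_minus_right side_dirs_minus)

text \<open>\<open>u + u'\<close> is a sample direction inside the cone;
  \<open>vmax_maximizes\<close> shows that the vertex chosen for it is extremal for every direction
  of the closed cone.\<close>

definition vmax :: "complex set \<Rightarrow> complex \<Rightarrow> complex \<Rightarrow> complex" where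
  "vmax P u u' = (SOME v. maximizes P (u + u') v)"

definition vmin :: "complex set \<Rightarrow> complex \<Rightarrow> complex \<Rightarrow> complex" where
  "vmin P u u' = vmax P (- u) (- u')"

definition nvec :: "complex set \<Rightarrow> complex \<Rightarrow> complex \<Rightarrow> complex" where
  "nvec P u u' = vmax P u u' - vmin P u u'"

text \<open>The side ratio of the necklace polygon, normalized so that the vertex on the ray of
  \<open>u\<close> is \<open>(1 / wid P u) *\<^sub>R u\<close>; see
  \<open>rstar_nvec\<close>.\<close>

definition rstar :: "complex set \<Rightarrow> complex \<Rightarrow> complex \<Rightarrow> real" where
  "rstar P u u' = cross2 u u' / (wid P u * wid P u')"

text \<open>The supporting line through \<open>v\<close> cuts \<open>P\<close> in a face. The face
  lies on a line and contains two distinct points, so its dimension is exactly one.\<close>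

lemma edge_through:
  assumes "convex_polygon P" "u \<noteq> 0" "maximizes P u v" "c \<in> P" "c \<noteq> v" "cross2 u c = cross2 u v"
  obtains s where "s edge_of P" "v \<in> s" "c \<in> s"
proof -
  define s where "s = P \<inter> {x. inner (\<i> * u) x = cross2 u v}"
  have cP: "convex P" using assms(1) by (simp add: convex_polygon_def polytope_imp_convex)
  have f: "s face_of P" unfolding s_def
    by (rule face_of_Int_supporting_hyperplane_le[OF cP])
       (use assms(3) in \<open>auto simp: maximizes_def cross2_eq_inner\<close>)
  have vs: "v \<in> s" "c \<in> s" using assms by (auto simp: s_def maximizes_def cross2_eq_inner)
  have "aff_dim s \<le> aff_dim {x. inner (\<i> * u) x = cross2 u v}"
    by (rule aff_dim_subset) (auto simp: s_def)
  also have "\<dots> = 1" using assms(2) by (subst aff_dim_hyperplane) auto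
  finally have "aff_dim s \<le> 1" .
  moreover have "aff_dim {v, c} \<le> aff_dim s" by (rule aff_dim_subset) (use vs in auto)
  moreover have "aff_dim {v, c} = 1" using assms(5) by (simp add: aff_dim_2)
  ultimately have "aff_dim s = 1" by simp
  with f vs show thesis using that by (auto simp: edge_of_def)
qed

text \<open>A tie yields an edge through \<open>v\<close> and \<open>c\<close>, and the vanishing
  determinant makes \<open>u\<close> parallel to \<open>c - v\<close>.\<close>

lemma side_dirs_of_tie:
  assumes "convex_polygon P" "u \<noteq> 0" "maximizes P u v" "c \<in> P" "c \<noteq> v" "cross2 u c = cross2 u v"
  shows "u \<in> side_dirs P"
proof -
  obtain s where s: "s edge_of P" "v \<in> s" "c \<in> s" using edge_through[OF assms] .
  define L where "L = (\<lambda>x. - v + x) ` (affine hull s)"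
  have L: "subspace L" unfolding L_def
    by (rule affine_diffs_subspace) (auto simp: s(2) hull_inc)
  have "affine_parallel (affine hull s) L"
    unfolding affine_parallel_def L_def by blast
  hence "L \<in> side_lines P" using L s(1) by (auto simp: side_lines_def)
  moreover have "c - v \<in> L" unfolding L_def using s(3) by (auto intro!: image_eqI[of _ _ c] hull_inc)
  moreover have "cross2 (c - v) u = 0" using assms(6) cross2_swap[of "c - v" u] by (simp add: cross2_linear)
  ultimately show ?thesis
    using cross2_zero_imp_scaleR[of "c - v" u] assms(5) L unfolding side_dirs_def
    by (metis UnionI eq_iff_diff_eq_0 subspace_scale)
qed

lemma maximizes_unique:
  assumes "convex_polygon P" "u \<notin> side_dirs P" "u \<noteq> 0" "maximizes P u v" "c \<in> P" "cross2 u c \<ge> cross2 u v"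
  shows "c = v"
  using side_dirs_of_tie[OF assms(1,3,4,5)] assms by (force simp: maximizes_def)

lemma maximizes_exists:
  assumes "convex_polygon P"
  shows "\<exists>v. maximizes P u v"
proof -
  have "compact P" "P \<noteq> {}" using assms by (auto simp: convex_polygon_def polytope_imp_compact)
  from continuous_attains_sup[OF this continuous_cross2[of P u]] show ?thesis
    by (auto simp: maximizes_def)
qed

text \<open>Turning the direction from \<open>u0\<close> towards \<open>u\<close>, the maximizer can only change at a side direction.\<close>

lemma maximizes_rotate:
  assumes P: "convex_polygon P" and v: "maximizes P u0 v"
    and nd: "\<And>t. 0 \<le> t \<Longrightarrow> t < 1 \<Longrightarrow> (1 - t) *\<^sub>R u0 + t *\<^sub>R u \<notin>
      side_dirs P"
    and nz: "\<And>t. 0 \<le> t \<Longrightarrow> t < 1 \<Longrightarrow> (1 - t) *\<^sub>R u0 + t *\<^sub>R u \<noteq> 0"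
  shows "maximizes P u v"
proof (rule ccontr)
  assume neg: "\<not> maximizes P u v"
  obtain V where V: "finite V" "P = convex hull V" using P by (auto simp: convex_polygon_def polytope_def)
  have VP: "V \<subseteq> P" using V by (auto simp: hull_inc)
  have hull_max: "maximizes P x v" if "\<forall>c\<in>V. cross2 x c \<le> cross2 x v" for x
  proof -
    have "convex hull V \<subseteq> {c. cross2 x c \<le> cross2 x v}"
      using that unfolding cross2_eq_inner
      by (intro hull_minimal convex_halfspace_le) auto
    thus ?thesis using v V by (auto simp: maximizes_def)
  qed
  \<comment> \<open>\<open>W\<close> collects the vertices that beat \<open>v\<close> at the end of
    the turn, and \<open>T c\<close> is the moment at which \<open>c\<close> catches up with
    \<open>v\<close>. At the earliest such moment \<open>v\<close> is still maximal but tied with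
    \<open>c\<close>, which forces a side direction.\<close>
  define W where "W = {c \<in> V. cross2 u c > cross2 u v}"
  define T where "T c = (cross2 u0 v - cross2 u0 c) / ((cross2 u0 v - cross2 u0 c) + (cross2 u c -
    cross2 u v))" for c
  have W: "finite W" "W \<noteq> {}" using V neg hull_max[of u] by (force simp: W_def)+
  then obtain c where c: "c \<in> W" "\<And>d. d \<in> W \<Longrightarrow> T c \<le> T d"
    by (metis (no_types, lifting) arg_min_if_finite(1) arg_min_least)
  have nn: "cross2 u0 v - cross2 u0 d \<ge> 0" if "d \<in> V" for d
    using v that VP by (auto simp: maximizes_def)
  have cV: "c \<in> V" "cross2 u c > cross2 u v" using c by (auto simp: W_def)
  have T: "0 \<le> T c" "T c < 1" using nn[OF cV(1)] cV(2) by (auto simp: T_def divide_simps)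
  define x where "x = (1 - T c) *\<^sub>R u0 + T c *\<^sub>R u"
  have xd: "cross2 x d - cross2 x v = T c * (cross2 u d - cross2 u v) - (1 - T c) * (cross2 u0 v -
    cross2 u0 d)" for d
    by (simp add: x_def cross2_linear algebra_simps)
  have "cross2 x d \<le> cross2 x v" if d: "d \<in> V" for d
  proof (cases "d \<in> W")
    case True
    have "T c \<le> T d" using c(2) True .
    moreover have "(cross2 u0 v - cross2 u0 d) + (cross2 u d - cross2 u v) > 0"
      using nn[OF d] True by (auto simp: W_def)
    ultimately have "T c * ((cross2 u0 v - cross2 u0 d) + (cross2 u d - cross2 u v)) \<le> cross2 u0 v -
      cross2 u0 d"
      by (simp add: T_def[of d] pos_le_divide_eq)
    with xd[of d] show ?thesis by (simp add: algebra_simps)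
  next
    case False
    hence "T c * (cross2 u d - cross2 u v) \<le> 0" using d T by (auto simp: W_def mult_nonneg_nonpos)
    moreover have "(1 - T c) * (cross2 u0 v - cross2 u0 d) \<ge> 0" using nn[OF d] T by simp
    ultimately show ?thesis using xd[of d] by simp
  qed
  hence mx: "maximizes P x v" using hull_max by blast
  have "(cross2 u0 v - cross2 u0 c) + (cross2 u c - cross2 u v) > 0" using nn[OF cV(1)] cV by auto
  hence "T c * ((cross2 u0 v - cross2 u0 c) + (cross2 u c - cross2 u v)) = cross2 u0 v - cross2 u0 c"
    by (simp add: T_def)
  hence "cross2 x c = cross2 x v" using xd[of c] by (simp add: algebra_simps)
  moreover have x: "x \<notin> side_dirs P" using nd T by (simp add: x_def)
  moreover have "x \<noteq> 0" using nz T by (simp add: x_def)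
  ultimately show False using side_dirs_of_tie[OF P _ mx, of c] cV VP by auto
qed

section \<open>Chains of polygons and the barrier\<close>

lemma cross2_eqI:
  assumes "cross2 u v \<noteq> 0" "cross2 u x = cross2 u y" "cross2 v x = cross2 v y"
  shows "x = y"
proof -
  have "cross2 u v *\<^sub>R (x - y) = 0"
    using assms cross2_expand[of u v "x - y"] cross2_swap[of "x - y" v] by (simp add: cross2_linear)
  thus ?thesis using assms(1) by simp
qed

lemma cone_coordinates:
  assumes "cross2 u v > 0" "cross2 u x \<ge> 0" "cross2 v x \<le> 0"
  obtains s t where "s \<ge> 0" "t \<ge> 0" "x = s *\<^sub>R u + t *\<^sub>R v"
proof
  show "x = (cross2 x v / cross2 u v) *\<^sub>R u + (cross2 u x / cross2 u v) *\<^sub>R v"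
    using assms(1) by (intro cross2_eqI[of u v]) (auto simp: cross2_linear cross2_swap[of v])
qed (use assms cross2_swap[of x v] in \<open>auto simp: field_simps\<close>)

lemma open_cone_coordinates:
  assumes "cross2 u v > 0" "cross2 u x > 0" "cross2 v x < 0"
  obtains s t where "s > 0" "t > 0" "x = s *\<^sub>R u + t *\<^sub>R v"
proof
  show "x = (cross2 x v / cross2 u v) *\<^sub>R u + (cross2 u x / cross2 u v) *\<^sub>R v"
    using assms(1) by (intro cross2_eqI[of u v]) (auto simp: cross2_linear cross2_swap[of v])
qed (use assms cross2_swap[of x v] in \<open>auto simp: field_simps\<close>)

lemma good_pair_nonzero:
  assumes "good_pair P u u'" shows "u \<noteq> 0" "u' \<noteq> 0"
  using assms by (auto simp: good_pair_def)

text \<open>On the way from \<open>u + u'\<close> to a direction of the closed cone all coefficients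
  stay positive until the very end, so no side direction is met and the maximizer persists.\<close>

lemma vmax_maximizes:
  assumes P: "convex_polygon P" and g: "good_pair P u u'" and st: "s \<ge> 0" "t \<ge> 0"
  shows "maximizes P (s *\<^sub>R u + t *\<^sub>R u') (vmax P u u')"
proof (rule maximizes_rotate[OF P])
  show "maximizes P (u + u') (vmax P u u')"
    unfolding vmax_def using maximizes_exists[OF P] by (rule someI_ex)
  fix r :: real assume r: "0 \<le> r" "r < 1"
  have eq: "(1 - r) *\<^sub>R (u + u') + r *\<^sub>R (s *\<^sub>R u + t *\<^sub>R u') = ((1 - r) + r * s) *\<^sub>R u + ((1 - r) + r *
    t) *\<^sub>R u'"
    by (simp add: algebra_simps)
  have pos: "(1 - r) + r * s > 0" "(1 - r) + r * t > 0" using r st by (simp_all add: add_pos_nonneg)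
  show "(1 - r) *\<^sub>R (u + u') + r *\<^sub>R (s *\<^sub>R u + t *\<^sub>R u') \<notin> side_dirs P"
    unfolding eq using g pos by (simp add: good_pair_def)
  have "cross2 u (((1 - r) + r * s) *\<^sub>R u + ((1 - r) + r * t) *\<^sub>R u') > 0"
    using g pos by (simp add: good_pair_def cross2_linear)
  thus "(1 - r) *\<^sub>R (u + u') + r *\<^sub>R (s *\<^sub>R u + t *\<^sub>R u') \<noteq> 0" unfolding eq by auto
qed

lemma vmin_maximizes:
  assumes "convex_polygon P" "good_pair P u u'" "s \<ge> 0" "t \<ge> 0"
  shows "maximizes P (- (s *\<^sub>R u + t *\<^sub>R u')) (vmin P u u')"
  using vmax_maximizes[OF assms(1) good_pair_minus[OF assms(2)] assms(3,4)] by (simp add: vmin_def)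

lemma vmax_in: "convex_polygon P \<Longrightarrow> good_pair P u u' \<Longrightarrow> vmax P u u' \<in> P"
  using vmax_maximizes[of P u u' 0 0] by (simp add: maximizes_def)

lemma vmin_in: "convex_polygon P \<Longrightarrow> good_pair P u u' \<Longrightarrow> vmin P u u' \<in> P"
  using vmin_maximizes[of P u u' 0 0] by (simp add: maximizes_def)

lemma cross2_nvec:
  assumes "convex_polygon P" "good_pair P u u'"
  shows "cross2 u (nvec P u u') = wid P u" "cross2 u' (nvec P u u') = wid P u'"
proof -
  note a = vmax_maximizes[OF assms, THEN maximizes_sup_cross]
  note b = vmin_maximizes[OF assms, THEN maximizes_sup_cross]
  show "cross2 u (nvec P u u') = wid P u"
    using a[of 1 0] b[of 1 0] by (simp add: nvec_def wid_def cross2_linear)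
  show "cross2 u' (nvec P u u') = wid P u'"
    using a[of 0 1] b[of 0 1] by (simp add: nvec_def wid_def cross2_linear)
qed

lemma wid_pos:
  assumes P: "convex_polygon P" and u: "u \<noteq> 0"
  shows "wid P u > 0"
proof -
  obtain v w where v: "maximizes P u v" and w: "maximizes P (- u) w"
    using maximizes_exists[OF P] by metis
  have wid: "wid P u = cross2 u v - cross2 u w"
    using v w by (simp add: wid_def maximizes_sup_cross)
  have le: "cross2 u w \<le> cross2 u p" "cross2 u p \<le> cross2 u v" if "p \<in> P" for p
    using v w that by (auto simp: maximizes_def)
  have "cross2 u w \<noteq> cross2 u v"
  proof
    assume eq: "cross2 u w = cross2 u v"
    have "P \<subseteq> {x. inner (\<i> * u) x = cross2 u v}"
      using le eq by (force simp: cross2_eq_inner)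
    hence "interior P \<subseteq> interior {x. inner (\<i> * u) x = cross2 u v}" by (rule interior_mono)
    also have "\<dots> = {}" using u by (intro interior_hyperplane) auto
    finally show False using P by (simp add: convex_polygon_def)
  qed
  with wid le[of w] w show ?thesis by (auto simp: maximizes_def)
qed

text \<open>By \<open>cross2_nvec\<close> both normalized boundary vectors have determinant 1 with
  the necklace vector, so their difference is parallel to it. Hence the points
  \<open>(1 / wid P u) *\<^sub>R u\<close> on consecutive rays form a necklace polygon.\<close>

lemma rstar_nvec:
  assumes P: "convex_polygon P" and g: "good_pair P u u'"
  shows "(1 / wid P u') *\<^sub>R u' = (1 / wid P u) *\<^sub>R u + rstar P u u' *\<^sub>R nvec P u u'"
proof -
  have g': "cross2 u u' > 0" using g by (simp add: good_pair_def)
  have w: "wid P u > 0" "wid P u' > 0" using good_pair_nonzero[OF g] P by (auto intro: wid_pos)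
  show ?thesis
    by (rule cross2_eqI[of u u'])
       (use g' w cross2_swap[of u' u] in \<open>auto simp: cross2_linear cross2_nvec[OF P g] rstar_def
         field_simps\<close>)
qed

section \<open>Chains of touching copies and their virtual continuations\<close>

definition sector :: "complex \<Rightarrow> complex \<Rightarrow> complex set" where
  "sector u u' = {x. cross2 u x \<ge> 0 \<and> cross2 u' x < 0}"

text \<open>Copy \<open>m\<close> consists of the points
  \<open>b m + kap m *\<^sub>R (p - A m)\<close> with \<open>p\<close> in \<open>P\<close>; a
  negative \<open>kap m\<close> gives a reflected copy. Seen from the origin, its tail is
  \<open>b m\<close> and its head is \<open>b (m + 1)\<close>, which is the tail of the next copy.
  \<open>sg\<close> accumulates the sizes; after \<open>K\<close> steps the sizes repeat and
  \<open>sg\<close> has grown by \<open>S\<close>.\<close>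

locale necklace_orbit =
  fixes P :: "complex set" and Prs :: "(complex \<times> complex) set"
    and kap :: "int \<Rightarrow> real" and A b :: "int \<Rightarrow> complex" and sg ::
      "int \<Rightarrow> real" and K :: int and S :: real
  assumes P: "convex_polygon P"
    and good: "(u, u') \<in> Prs \<Longrightarrow> good_pair P u u'"
    and kap0: "kap m \<noteq> 0"
    and A_in: "A m \<in> P"
    and b_Suc: "b (m + 1) = b m + kap m *\<^sub>R (A (m + 1) - A m)"
    and tail: "p \<in> P \<Longrightarrow> p \<noteq> A m \<Longrightarrow> cross2 (b m) (kap m *\<^sub>R (p - A m)) > 0"
    and head: "p \<in> P \<Longrightarrow> p \<noteq> A (m + 1) \<Longrightarrow> cross2 (b (m + 1)) (kap m *\<^sub>R (p
      - A (m + 1))) < 0"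
    and kap_per: "kap (m + K) = kap m"
    and sg_Suc: "sg (m + 1) = sg m + \<bar>kap m\<bar>"
    and sg_per: "sg (m + K) = sg m + S"
begin

text \<open>A reflected copy has its two extremal vertices exchanged, hence the test on the sign of
  \<open>kap i\<close>.\<close>

definition tail_vertex :: "complex \<Rightarrow> complex \<Rightarrow> int \<Rightarrow> complex" where
  "tail_vertex u u' i = (if kap i > 0 then vmin P u u' else vmax P u u')"

definition head_vertex :: "complex \<Rightarrow> complex \<Rightarrow> int \<Rightarrow> complex" where
  "head_vertex u u' i = (if kap i > 0 then vmax P u u' else vmin P u u')"

lemma tail_vertex_in: "(u, u') \<in> Prs \<Longrightarrow> tail_vertex u u' i \<in> P"
  and head_vertex_in: "(u, u') \<in> Prs \<Longrightarrow> head_vertex u u' i \<in> P"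
  by (auto simp: tail_vertex_def head_vertex_def good vmax_in[OF P] vmin_in[OF P])

lemma head_minus_tail_vertex: "kap i *\<^sub>R (head_vertex u u' i - tail_vertex u u' i)
  = \<bar>kap i\<bar> *\<^sub>R nvec P u u'"
  by (auto simp: tail_vertex_def head_vertex_def nvec_def algebra_simps)

lemma tail_head_vertex_extreme:
  assumes "(u, u') \<in> Prs" "p \<in> P" "s \<ge> 0" "t \<ge> 0"
  shows "cross2 (s *\<^sub>R u + t *\<^sub>R u') (kap i *\<^sub>R (p - tail_vertex u u' i)) \<ge> 0"
    and "cross2 (s *\<^sub>R u + t *\<^sub>R u') (kap i *\<^sub>R (p - head_vertex u u' i)) \<le> 0"
proof -
  define x where "x = s *\<^sub>R u + t *\<^sub>R u'"
  have a: "cross2 x p \<le> cross2 x (vmax P u u')"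
    using vmax_maximizes[OF P good[OF assms(1)] assms(3,4)] assms(2) by (simp add: maximizes_def x_def)
  have b: "cross2 x p \<ge> cross2 x (vmin P u u')"
    using vmin_maximizes[OF P good[OF assms(1)] assms(3,4)] assms(2) unfolding x_def[symmetric]
    by (simp add: maximizes_def)
  show "cross2 (s *\<^sub>R u + t *\<^sub>R u') (kap i *\<^sub>R (p - tail_vertex u u' i)) \<ge> 0"
    "cross2 (s *\<^sub>R u + t *\<^sub>R u') (kap i *\<^sub>R (p - head_vertex u u' i)) \<le> 0"
    using a b kap0[of i] unfolding x_def[symmetric]
    by (auto simp: tail_vertex_def head_vertex_def cross2_linear mult_nonneg_nonneg mult_nonpos_nonpos
      mult_nonneg_nonpos mult_nonpos_nonneg)
qed

lemma tail_vertex_extreme: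
  assumes "(u, u') \<in> Prs" "p \<in> P"
  shows "cross2 u (kap i *\<^sub>R (p - tail_vertex u u' i)) \<ge> 0" "cross2 u' (kap i *\<^sub>R (p - tail_vertex u u'
    i)) \<ge> 0"
  using tail_head_vertex_extreme(1)[OF assms, of 1 0 i] tail_head_vertex_extreme(1)[OF assms, of 0 1 i]
    by auto

lemma size_from_tail_vertex:
  assumes "(u, u') \<in> Prs" "p \<in> P"
  shows "cross2 u (kap i *\<^sub>R (p - tail_vertex u u' i)) \<le> \<bar>kap i\<bar> * wid P u"
    "cross2 u' (kap i *\<^sub>R (p - tail_vertex u u' i)) \<le> \<bar>kap i\<bar> * wid P u'"
proof -
  have "kap i *\<^sub>R (p - tail_vertex u u' i) = kap i *\<^sub>R (p - head_vertex u u' i) + \<bar>kap i\<bar> *\<^sub>R nvec P u u'"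
    unfolding head_minus_tail_vertex[symmetric] by (simp add: algebra_simps)
  thus "cross2 u (kap i *\<^sub>R (p - tail_vertex u u' i)) \<le> \<bar>kap i\<bar> * wid P u"
    "cross2 u' (kap i *\<^sub>R (p - tail_vertex u u' i)) \<le> \<bar>kap i\<bar> * wid P u'"
    using tail_head_vertex_extreme(2)[OF assms, of 1 0 i] tail_head_vertex_extreme(2)[OF assms, of 0 1 i]
      cross2_nvec[OF P good[OF assms(1)]] by (simp_all add: cross2_add_right del: cross2_scaleR_right)
       (simp_all add: algebra_simps)
qed

text \<open>If \<open>b m\<close> lies in the closed cone, the tail vertex of the cone is extremal
  for the direction \<open>b m\<close> itself, and the strict inequality in \<open>tail\<close>
  leaves no other contact point.\<close>

lemma contact_eq_tail_vertex:
  assumes "(u, u') \<in> Prs" "cross2 u (b m) \<ge> 0" "cross2 u' (b m) \<le> 0"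
  shows "A m = tail_vertex u u' m"
proof (rule ccontr)
  assume "A m \<noteq> tail_vertex u u' m"
  hence "cross2 (b m) (kap m *\<^sub>R (tail_vertex u u' m - A m)) > 0"
    using tail[OF tail_vertex_in[OF assms(1)]] by metis
  moreover obtain s t where "s \<ge> 0" "t \<ge> 0" "b m = s *\<^sub>R u + t *\<^sub>R u'"
    using cone_coordinates[OF _ assms(2,3)] good[OF assms(1)] by (auto simp: good_pair_def)
  ultimately show False using tail_head_vertex_extreme(1)[OF assms(1) A_in, of s t m m]
    by (simp add: cross2_diff_right algebra_simps)
qed

lemma contact_eq_head_vertex:
  assumes "(u, u') \<in> Prs" "cross2 u (b (m + 1)) \<ge> 0" "cross2 u' (b (m + 1)) \<le> 0"
  shows "A (m + 1) = head_vertex u u' m"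
proof (rule ccontr)
  assume "A (m + 1) \<noteq> head_vertex u u' m"
  hence "cross2 (b (m + 1)) (kap m *\<^sub>R (head_vertex u u' m - A (m + 1))) < 0"
    using head[OF head_vertex_in[OF assms(1)]] by metis
  moreover obtain s t where "s \<ge> 0" "t \<ge> 0" "b (m + 1) = s *\<^sub>R u + t *\<^sub>R u'"
    using cone_coordinates[OF _ assms(2,3)] good[OF assms(1)] by (auto simp: good_pair_def)
  ultimately show False using tail_head_vertex_extreme(2)[OF assms(1) A_in, of s t "m" "m + 1"]
    by (simp add: cross2_diff_right algebra_simps)
qed

lemma sg_mono: "i \<le> j \<Longrightarrow> sg i \<le> sg j"
  by (induction j rule: int_ge_induct) (auto simp: sg_Suc intro: order_trans)

lemma kap_shift: "kap (i + T * K) = kap i"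
proof (induction T rule: int_induct[where k = 0])
  case (step1 T) thus ?case using kap_per[of "i + T * K"] by (simp add: algebra_simps)
next
  case (step2 T) thus ?case using kap_per[of "i + (T - 1) * K"] by (simp add: algebra_simps)
qed simp

lemma sg_shift: "sg (i + T * K) = sg i + of_int T * S"
proof (induction T rule: int_induct[where k = 0])
  case (step1 T) thus ?case using sg_per[of "i + T * K"] by (simp add: algebra_simps)
next
  case (step2 T) thus ?case using sg_per[of "i + (T - 1) * K"] by (simp add: algebra_simps)
qed simp

text \<open>The displacement of the point \<open>p\<close> of the \<open>i\<close>-th polygon from \<open>q\<close>, in the chain of polygons
  that passes through the tail \<open>x\<close> of the \<open>m\<close>-th one and stays in the cone spanned by \<open>u\<close>, \<open>u'\<close> forever.\<close>

definition disp :: "complex \<Rightarrow> complex \<Rightarrow> complex \<Rightarrow> complex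
  \<Rightarrow> int \<Rightarrow> int \<Rightarrow> complex \<Rightarrow> complex" where
  "disp u u' q x m i p = x + (sg i - sg m) *\<^sub>R nvec P u u' + kap i *\<^sub>R (p - tail_vertex u u' i) - q"

text \<open>Whether the virtual chain through \<open>x\<close> meets the closed cone of
  \<open>u\<close> and \<open>u'\<close> translated to the apex \<open>q\<close>. The index
  \<open>i\<close> ranges over all integers, so that whole periods can be shifted in both
  directions.\<close>

definition reach :: "complex \<Rightarrow> complex \<Rightarrow> complex \<Rightarrow> complex
  \<Rightarrow> int \<Rightarrow> bool" where
  "reach u u' q x m \<longleftrightarrow>
     (\<exists>i. \<exists>p\<in>P. cross2 u (disp u u' q x m i p) \<ge> 0 \<and> cross2 u' (disp u u' q x m i p) \<le> 0)"

lemma tail_vertex_shift: "tail_vertex u u' (i + T * K) = tail_vertex u u' i"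
  by (simp add: tail_vertex_def kap_shift)

text \<open>Moving \<open>T\<close> periods along the virtual chain translates each copy by
  \<open>of_int T * S\<close> times the necklace vector, so moving the apex by that amount is
  matched by reindexing the copies.\<close>

lemma reach_shift_imp:
  assumes "reach u u' q x m"
  shows "reach u u' (q + (of_int T * S) *\<^sub>R nvec P u u') x m"
proof -
  have "disp u u' (q + (of_int T * S) *\<^sub>R nvec P u u') x m (i + T * K) p = disp u u' q x m i p" for i p
    unfolding disp_def kap_shift sg_shift tail_vertex_shift by (simp add: algebra_simps)
  thus ?thesis using assms unfolding reach_def by metis
qed

lemma reach_shift: "reach u u' (q + (of_int T * S) *\<^sub>R nvec P u u') x m \<longleftrightarrow> reach u u' q x m"
  using reach_shift_imp[of u u' q x m T] reach_shift_imp[of u u' "q + (of_int T * S) *\<^sub>R nvec P u u'" x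
    m "- T"]
  by auto

text \<open>With both contact points in the cone, the actual step is a step of the virtual chain, so
  both positions determine the same virtual chain.\<close>

lemma reach_same_sector:
  assumes "(u, u') \<in> Prs" "b m \<in> sector u u'" "b (m + 1) \<in> sector u u'"
  shows "reach u u' q (b (m + 1)) (m + 1) \<longleftrightarrow> reach u u' q (b m) m"
proof -
  have "A m = tail_vertex u u' m" "A (m + 1) = head_vertex u u' m"
    using assms by (auto intro!: contact_eq_tail_vertex contact_eq_head_vertex simp: sector_def)
  hence "b (m + 1) = b m + \<bar>kap m\<bar> *\<^sub>R nvec P u u'" using b_Suc[of m] by (simp add: head_minus_tail_vertex)
  hence "disp u u' q (b (m + 1)) (m + 1) i p = disp u u' q (b m) m i p" for i p
    unfolding disp_def sg_Suc by (simp add: algebra_simps)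
  thus ?thesis by (simp add: reach_def)
qed

section \<open>Passing from one cone to the next\<close>

lemma ray_crossing:
  assumes x: "x \<in> P" "cross2 v (c + k *\<^sub>R (x - a) - q) \<le> 0" "cross2 w (c + k *\<^sub>R (x - a) - q) \<ge> 0"
    and z: "z \<in> P" "cross2 v (c + k *\<^sub>R (z - a) - q) \<ge> 0" "cross2 w (c + k *\<^sub>R (z - a) - q) \<ge> 0"
  shows "\<exists>p\<in>P. cross2 v (c + k *\<^sub>R (p - a) - q) = 0 \<and> cross2 w (c + k *\<^sub>R (p - a) - q) \<ge> 0"
proof -
  define h where "h p = c + k *\<^sub>R (p - a) - q" for p
  define X Z where "X = cross2 v (h x)" and "Z = cross2 v (h z)"
  show ?thesis
  proof (cases "Z = X")
    case True
    thus ?thesis using x z by (intro bexI[of _ x]) (auto simp: X_def Z_def h_def)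
  next
    case False
    hence XZ: "X \<le> 0" "Z \<ge> 0" "Z - X > 0" using x z by (auto simp: X_def Z_def h_def)
    \<comment> \<open>The zero of the linear interpolation between the determinants \<open>X\<close>
      and \<open>Z\<close>; convexity puts the corresponding point of the segment into
      \<open>P\<close>.\<close>
    define s where "s = - X / (Z - X)"
    have s: "0 \<le> s" "s \<le> 1" using XZ by (auto simp: s_def divide_simps)
    define p where "p = (1 - s) *\<^sub>R x + s *\<^sub>R z"
    have "convex P" using P by (simp add: convex_polygon_def polytope_imp_convex)
    hence pP: "p \<in> P" using x z s unfolding p_def by (auto intro: convexD)
    have hp: "h p = (1 - s) *\<^sub>R h x + s *\<^sub>R h z" by (simp add: h_def p_def algebra_simps)
    have "cross2 v (h p) = X + s * (Z - X)" by (simp add: hp cross2_linear X_def Z_def algebra_simps)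
    also have "\<dots> = 0" using XZ by (simp add: s_def)
    finally have "cross2 v (h p) = 0" .
    moreover have "cross2 w (h p) \<ge> 0"
      using s x(3) z(3) unfolding hp by (simp add: cross2_linear h_def[symmetric])
    ultimately show ?thesis using pP unfolding h_def by blast
  qed
qed

text \<open>The right-hand side says that the crossing copy \<open>m\<close> meets the ray from
  \<open>q\<close> in direction \<open>u'\<close>. If an earlier copy reaches the translated cone,
  then so does \<open>b m\<close>, a point of copy \<open>m\<close>; the head vertex of copy
  \<open>m\<close> is on or beyond the line of \<open>u'\<close>, and convexity gives a point on the
  ray. A later copy reaches the cone only in the borderline case that \<open>b (m + 1)\<close> lies
  on the line of \<open>u'\<close>.\<close>

lemma reach_before_ray:
  assumes uu: "(u, u') \<in> Prs" and bm: "b m \<in> sector u u'"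
    and uu': "(u', u'') \<in> Prs" and bm': "b (m + 1) \<in> sector u' u''"
    and q: "cross2 u' q = 0"
  shows "reach u u' q (b m) m \<longleftrightarrow>
    (\<exists>p\<in>P. cross2 u' (b m + kap m *\<^sub>R (p - A m) - q) = 0 \<and> cross2 u (b m + kap m *\<^sub>R (p - A m) - q) \<ge> 0)"
    (is "?L \<longleftrightarrow> (\<exists>p\<in>P. ?R p)")
proof
  note w = cross2_nvec[OF P good[OF uu]]
  have wp: "wid P u > 0" "wid P u' > 0" using good_pair_nonzero[OF good[OF uu]] P by (auto intro: wid_pos)
  have Am: "A m = tail_vertex u u' m" using bm by (intro contact_eq_tail_vertex[OF uu]) (auto simp:
    sector_def)
  have dm: "disp u u' q (b m) m m p = b m + kap m *\<^sub>R (p - A m) - q" for p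
    by (simp add: disp_def Am)
  show "\<exists>p\<in>P. ?R p \<Longrightarrow> ?L"
    unfolding reach_def by (metis dm order_refl)
  \<comment> \<open>The virtual head maximizes the determinant with \<open>u'\<close> over copy
    \<open>m\<close>, so it is at least as far across the line as the actual head
    \<open>b (m + 1)\<close>.\<close>
  have tp: "cross2 u' (b m + kap m *\<^sub>R (head_vertex u u' m - A m)) \<ge> cross2 u' (b (m + 1))"
    using tail_head_vertex_extreme(2)[OF uu A_in[of "m+1"], of 0 1 m] unfolding b_Suc
      by (simp add: cross2_linear algebra_simps)
  have tpw: "kap m *\<^sub>R (head_vertex u u' m - A m) = \<bar>kap m\<bar> *\<^sub>R nvec P u u'"
    by (simp add: Am head_minus_tail_vertex)
  have lb': "cross2 u' (b (m + 1)) \<ge> 0" using bm' by (simp add: sector_def)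
  have crossing: "\<exists>p\<in>P. ?R p"
    if x: "x \<in> P" "cross2 u (b m + kap m *\<^sub>R (x - A m) - q) \<ge> 0" "cross2 u' (b m + kap m *\<^sub>R (x - A m) -
      q) \<le> 0" for x
  proof (rule ray_crossing[OF x(1) x(3) x(2) head_vertex_in[OF uu, of m]])
    show "cross2 u' (b m + kap m *\<^sub>R (head_vertex u u' m - A m) - q) \<ge> 0"
      using tp lb' q by (simp add: cross2_linear)
    show "cross2 u (b m + kap m *\<^sub>R (head_vertex u u' m - A m) - q) \<ge> 0"
      using x(2) tail_head_vertex_extreme(2)[OF uu x(1), of 1 0 m]
        by (simp add: cross2_linear algebra_simps)
  qed
  assume ?L
  then obtain i p where p: "p \<in> P" and y: "cross2 u (disp u u' q (b m) m i p) \<ge> 0"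
    "cross2 u' (disp u u' q (b m) m i p) \<le> 0"
    by (auto simp: reach_def)
  have y1: "cross2 u (disp u u' q (b m) m i p) = cross2 u (b m - q) + (sg i - sg m) * wid P u + cross2 u
    (kap i *\<^sub>R (p - tail_vertex u u' i))"
    and y2: "cross2 u' (disp u u' q (b m) m i p) = cross2 u' (b m) + (sg i - sg m) * wid P u' + cross2
      u' (kap i *\<^sub>R (p - tail_vertex u u' i))"
    by (simp_all add: disp_def cross2_linear w q algebra_simps)
  consider "i < m" | "i = m" | "i > m" by linarith
  then show "\<exists>p\<in>P. ?R p"
  proof cases
    case 1
    have "sg i + \<bar>kap i\<bar> \<le> sg m" using sg_mono[of "i + 1" m] 1 by (simp add: sg_Suc)
    hence "(sg i + \<bar>kap i\<bar> - sg m) * wid P u \<le> 0" using wp by (simp add: mult_nonpos_nonneg)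
    hence "cross2 u (b m - q) \<ge> 0" using y(1) size_from_tail_vertex(1)[OF uu p, of i] unfolding y1
      by (simp add: algebra_simps)
    moreover have "cross2 u' (b m) < 0" using bm by (simp add: sector_def)
    ultimately show ?thesis using q by (intro crossing[OF A_in[of m]]) (auto simp: cross2_linear)
  next
    case 2
    with crossing[OF p] y show ?thesis by (simp add: dm)
  next
    case 3
    have "sg (m + 1) \<le> sg i" using sg_mono[of "m + 1" i] 3 by simp
    hence s1: "(sg i - sg (m + 1)) * wid P u' \<ge> 0" using wp by simp
    have e1: "cross2 u' (b m) + \<bar>kap m\<bar> * wid P u' \<ge> cross2 u' (b (m + 1))"
      using tp unfolding tpw by (simp add: cross2_linear w)
    have e2: "cross2 u' (kap i *\<^sub>R (p - tail_vertex u u' i)) \<ge> 0" using tail_vertex_extreme(2)[OF uu p] .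
    have "cross2 u' (b m) + \<bar>kap m\<bar> * wid P u' + (sg i - sg (m + 1)) * wid P u' + cross2 u' (kap i *\<^sub>R
      (p - tail_vertex u u' i)) \<le> 0"
      using y(2) unfolding y2 sg_Suc by (simp add: algebra_simps)
    \<comment> \<open>The sum bounds from above three nonnegative quantities whose total is at most
      0, so each of them vanishes. The only point left for the later copy is
      \<open>b (m + 1)\<close>, which copy \<open>m\<close> contains as well.\<close>
    hence l0: "cross2 u' (b (m + 1)) = 0" and s0: "(sg i - sg (m + 1)) * wid P u' = 0"
      and p0: "cross2 u' (kap i *\<^sub>R (p - tail_vertex u u' i)) = 0"
      using s1 e1 e2 lb' by linarith+
    have im: "i = m + 1"
    proof (rule ccontr)
      assume "i \<noteq> m + 1"
      hence "sg (m + 1 + 1) \<le> sg i" using 3 by (intro sg_mono) auto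
      hence "sg (m + 1) < sg i" using kap0[of "m + 1"] unfolding sg_Suc[of "m + 1"] by simp
      with s0 wp show False by simp
    qed
    have "u' \<noteq> 0" using good_pair_nonzero[OF good[OF uu]] by blast
    then obtain t where t: "b (m + 1) = t *\<^sub>R u'" using cross2_zero_imp_scaleR[OF l0] by blast
    have "t > 0"
      using bm' good[OF uu'] cross2_swap[of u'' u'] unfolding t sector_def good_pair_def
      by (auto simp: mult_less_0_iff zero_less_mult_iff)
    hence bu: "cross2 u (b (m + 1)) \<ge> 0" using good[OF uu] by (simp add: t good_pair_def)
    have At: "A (m + 1) = head_vertex u u' m" and Ab: "A (m + 1) = tail_vertex u u' (m + 1)"
      using bu l0 by (auto intro!: contact_eq_head_vertex[OF uu] contact_eq_tail_vertex[OF uu])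
    have "p = A (m + 1)"
    proof (rule ccontr)
      assume "p \<noteq> A (m + 1)"
      from tail[OF p this] p0 show False unfolding t Ab im by auto
    qed
    hence "disp u u' q (b m) m i p = b (m + 1) - q"
      unfolding disp_def im sg_Suc b_Suc At[symmetric] Ab[symmetric]
      using tpw At by (simp add: algebra_simps)
    hence "cross2 u (b (m + 1) - q) \<ge> 0" using y by simp
    thus ?thesis using l0 q A_in[of "m + 1"] unfolding b_Suc by (auto simp: cross2_linear)
  qed
qed

text \<open>Counterpart of \<open>reach_before_ray\<close> with the tail vertex in place of the head
  vertex. If a later copy reaches the translated cone, then so does \<open>b (m + 1)\<close>, a
  point of copy \<open>m\<close>. Earlier copies lie strictly before the line of \<open>u'\<close>,
  because \<open>b m\<close> does, and cannot reach it.\<close>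

lemma reach_after_ray:
  assumes uu: "(u', u'') \<in> Prs" and bm': "b (m + 1) \<in> sector u' u''"
    and bm: "cross2 u' (b m) < 0"
    and q: "cross2 u' q = 0"
  shows "reach u' u'' q (b (m + 1)) (m + 1) \<longleftrightarrow>
    (\<exists>p\<in>P. cross2 u' (b m + kap m *\<^sub>R (p - A m) - q) = 0 \<and> cross2 u'' (b m + kap m *\<^sub>R (p - A m) - q) \<le> 0)"
    (is "?L \<longleftrightarrow> (\<exists>p\<in>P. ?R p)")
proof
  note w = cross2_nvec[OF P good[OF uu]]
  have wp: "wid P u' > 0" "wid P u'' > 0" using good_pair_nonzero[OF good[OF uu]] P by (auto intro: wid_pos)
  have At: "A (m + 1) = head_vertex u' u'' m" using bm' by (intro contact_eq_head_vertex[OF uu]) (auto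
    simp: sector_def)
  have dm: "disp u' u'' q (b (m + 1)) (m + 1) m p = b m + kap m *\<^sub>R (p - A m) - q" for p
    unfolding disp_def b_Suc sg_Suc At using head_minus_tail_vertex[of m u' u'']
      by (simp add: algebra_simps)
  show "\<exists>p\<in>P. ?R p \<Longrightarrow> ?L"
    unfolding reach_def by (metis dm order_refl)
  have bt: "cross2 u' (b m + kap m *\<^sub>R (tail_vertex u' u'' m - A m)) \<le> cross2 u' (b m)"
    using tail_vertex_extreme(1)[OF uu A_in[of m], of m] by (simp add: cross2_linear algebra_simps)
  have btw: "b m + kap m *\<^sub>R (tail_vertex u' u'' m - A m) = b (m + 1) - \<bar>kap m\<bar> *\<^sub>R nvec P u' u''"
    unfolding b_Suc At using head_minus_tail_vertex[of m u' u''] by (simp add: algebra_simps)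
  have crossing: "\<exists>p\<in>P. ?R p"
    if x: "x \<in> P" "cross2 u' (b m + kap m *\<^sub>R (x - A m) - q) \<ge> 0" "cross2 u'' (b m + kap m *\<^sub>R (x - A m)
      - q) \<le> 0" for x
  proof -
    have 1: "cross2 u' (b m + kap m *\<^sub>R (tail_vertex u' u'' m - A m) - q) \<le> 0"
      using bt bm q by (simp add: cross2_linear)
    have "cross2 u'' (b m + kap m *\<^sub>R (tail_vertex u' u'' m - A m) - q) \<le> 0"
      using x(3) tail_vertex_extreme(2)[OF uu x(1), of m] by (simp add: cross2_linear algebra_simps)
    with ray_crossing[of "tail_vertex u' u'' m" u' "b m" "kap m" "A m" q
      "- u''" x] 1 x tail_vertex_in[OF uu]
    show ?thesis by auto
  qed
  assume ?L
  then obtain i p where p: "p \<in> P" and y: "cross2 u' (disp u' u'' q (b (m + 1)) (m + 1) i p) \<ge> 0"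
      "cross2 u'' (disp u' u'' q (b (m + 1)) (m + 1) i p) \<le> 0"
    by (auto simp: reach_def)
  have y1: "cross2 u' (disp u' u'' q (b (m + 1)) (m + 1) i p)
    = cross2 u' (b (m + 1)) + (sg i - sg (m + 1)) * wid P u' + cross2 u' (kap i *\<^sub>R (p - tail_vertex u'
    u'' i))"
    and y2: "cross2 u'' (disp u' u'' q (b (m + 1)) (m + 1) i p)
      = cross2 u'' (b (m + 1) - q) + (sg i - sg (m + 1)) * wid P u'' + cross2 u'' (kap i *\<^sub>R (p -
      tail_vertex u' u'' i))"
    by (simp_all add: disp_def cross2_linear w q algebra_simps)
  consider "i < m" | "i = m" | "i > m" by linarith
  then show "\<exists>p\<in>P. ?R p"
  proof cases
    case 1
    have "sg i + \<bar>kap i\<bar> \<le> sg m" using sg_mono[of "i + 1" m] 1 by (simp add: sg_Suc)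
    hence "(sg i + \<bar>kap i\<bar> - sg m) * wid P u' \<le> 0" using wp by (simp add: mult_nonpos_nonneg)
    moreover have "cross2 u' (b (m + 1)) - \<bar>kap m\<bar> * wid P u' < 0"
      using bt bm unfolding btw by (simp add: cross2_linear w)
    ultimately show ?thesis using y(1) size_from_tail_vertex(1)[OF uu p, of i] unfolding y1 sg_Suc
      by (simp add: algebra_simps)
  next
    case 2
    with crossing[OF p] y show ?thesis by (simp add: dm)
  next
    case 3
    have "sg (m + 1) \<le> sg i" using sg_mono[of "m + 1" i] 3 by simp
    hence "(sg i - sg (m + 1)) * wid P u'' \<ge> 0" using wp by simp
    hence "cross2 u'' (b (m + 1) - q) \<le> 0" using y(2) tail_vertex_extreme(2)[OF uu p, of i] unfolding y2
      by linarith
    moreover have "cross2 u' (b (m + 1) - q) \<ge> 0" using bm' q by (simp add: sector_def cross2_linear)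
    ultimately show ?thesis by (intro crossing[OF A_in[of "m + 1"]]) (simp_all add: b_Suc)
  qed
qed

text \<open>On the line of \<open>u'\<close> both side conditions single out the nonnegative
  multiples of \<open>u'\<close>, so the two characterizations describe the same intersection of the
  crossing copy with a ray.\<close>

lemma reach_across_ray:
  assumes uu: "(u, u') \<in> Prs" "(u', u'') \<in> Prs" and b: "b m \<in> sector u u'" "b (m + 1) \<in> sector u' u''"
    and q: "cross2 u' q = 0"
  shows "reach u' u'' q (b (m + 1)) (m + 1) \<longleftrightarrow> reach u u' q (b m) m"
proof -
  have "cross2 u y \<ge> 0 \<longleftrightarrow> cross2 u'' y \<le> 0" if y0: "cross2 u' y = 0" for y
  proof -
    obtain t where "y = t *\<^sub>R u'"
      using cross2_zero_imp_scaleR[OF y0] good_pair_nonzero[OF good[OF uu(1)]] by blast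
    thus ?thesis using good[OF uu(1)] good[OF uu(2)] cross2_swap[of u'' u']
      by (auto simp: good_pair_def zero_le_mult_iff mult_le_0_iff)
  qed
  thus ?thesis
    using reach_before_ray[OF uu(1) b(1) uu(2) b(2) q] reach_after_ray[OF uu(2) b(2) _ q] b(1)
    by (auto simp: sector_def)
qed

end

text \<open>The half-open sectors partition the punctured plane. By \<open>next_sector\<close>, a
  counterclockwise move of bounded length far from the origin passes at most one ray.
  Quasi-rationality enters through \<open>lattice\<close>: scaling by \<open>M0\<close> turns every
  necklace side into an integer number of periods.\<close>

locale necklace_orbit_sectors = necklace_orbit +
  fixes M0 :: real
  assumes fin: "finite Prs"
    and cover: "x \<noteq> 0 \<Longrightarrow> \<exists>u u'. (u, u') \<in> Prs \<and> x \<in> sector u u'"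
    and uniq: "(u, u') \<in> Prs \<Longrightarrow> (v, v') \<in> Prs \<Longrightarrow> x \<in> sector u u'
      \<Longrightarrow> x \<in> sector v v' \<Longrightarrow> u = v \<and> u' = v'"
    and next_sector: "\<exists>R. \<forall>x y u u'. (u, u') \<in> Prs \<longrightarrow> x \<in> sector u u' \<longrightarrow> norm x \<ge> R \<longrightarrow>
        norm (y - x) \<le> D \<longrightarrow> cross2 x y \<ge> 0 \<longrightarrow>
        y \<in> sector u u' \<or> (\<exists>u''. (u', u'') \<in> Prs \<and> y \<in> sector u' u'')"
    and b0: "b m \<noteq> 0"
    and K: "K > 0"
    and M0: "M0 > 0"
    and lattice: "(u, u') \<in> Prs \<Longrightarrow> \<exists>T::int. M0 * rstar P u u' = of_int T * S"
begin

section \<open>Distances to the origin and the barrier argument\<close>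

lemma polygon_size: "\<exists>D\<ge>0. \<forall>i. \<forall>p\<in>P. \<forall>p'\<in>P. norm (kap i *\<^sub>R (p - p')) \<le> D"
proof -
  have "bounded P" using P by (simp add: convex_polygon_def polytope_imp_bounded)
  then obtain B where B: "\<And>p. p \<in> P \<Longrightarrow> norm p \<le> B" by (auto simp: bounded_iff)
  define c where "c = (\<Sum>i\<in>{0..<K}. \<bar>kap i\<bar>)"
  have kc: "\<bar>kap i\<bar> \<le> c" for i
  proof -
    have "kap (i mod K) = kap i"
      using kap_shift[of "i mod K" "i div K"] by simp
    moreover have "\<bar>kap (i mod K)\<bar> \<le> c" unfolding c_def
      by (rule member_le_sum) (use K in auto)
    ultimately show ?thesis by simp
  qed
  have c: "c \<ge> 0" by (simp add: c_def sum_nonneg)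
  have "B \<ge> 0" using B[OF A_in] norm_ge_zero order_trans by blast
  show ?thesis
  proof (intro exI[of _ "c * (2 * B)"] conjI allI ballI)
    show "c * (2 * B) \<ge> 0" using c \<open>B \<ge> 0\<close> by simp
    fix i p p' assume "p \<in> P" "p' \<in> P"
    hence "norm (p - p') \<le> 2 * B" using B[of p] B[of p'] norm_triangle_ineq4[of p p'] by linarith
    thus "norm (kap i *\<^sub>R (p - p')) \<le> c * (2 * B)" using kc[of i] c by (simp add: mult_mono)
  qed
qed

text \<open>The vertex on the ray of \<open>u\<close> of the normalized necklace polygon scaled by
  \<open>M\<close>.\<close>

definition base :: "real \<Rightarrow> complex \<Rightarrow> complex" where
  "base M u = (M / wid P u) *\<^sub>R u"

lemma reach_far: "\<exists>e>0. \<exists>D. \<forall>M u u' x m. M \<ge> 0 \<longrightarrow> (u, u') \<in> Prs \<longrightarrow> reach u u' (base M u) x m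
  \<longrightarrow> norm x \<ge> M * e - D"
proof -
  obtain D where D: "\<And>i p p'. p \<in> P \<Longrightarrow> p' \<in> P \<Longrightarrow> norm (kap i *\<^sub>R (p -
    p')) \<le> D" using polygon_size by blast
  define F where "F = (\<lambda>(u, u'). norm u * wid P u' + norm u' * wid P u)"
  define E where "E = (\<lambda>(u, u'). cross2 u u' / F (u, u'))"
  \<comment> \<open>A slope valid for all cones at once; inserting 1 keeps the set nonempty.\<close>
  define e where "e = Min (insert 1 (E ` Prs))"
  have pos: "F (u, u') > 0 \<and> E (u, u') > 0" if "(u, u') \<in> Prs" for u u'
  proof -
    have "u \<noteq> 0" "u' \<noteq> 0" "cross2 u u' > 0" using good[OF that] good_pair_nonzero
      by (auto simp: good_pair_def)
    moreover have "wid P u > 0" "wid P u' > 0" using calculation P by (auto intro: wid_pos)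
    ultimately show ?thesis by (auto simp: F_def E_def intro!: divide_pos_pos add_pos_pos)
  qed
  have "e > 0" unfolding e_def using fin pos by (auto simp: Min_gr_iff)
  have "norm x \<ge> M * e - D" if "M \<ge> 0" and uu: "(u, u') \<in> Prs" and
    "reach u u' (base M u) x m" for M u u' x m
  proof -
    from that(3) obtain i p where p: "p \<in> P" "cross2 u (disp u u' (base M u) x m i p) \<ge> 0"
      "cross2 u' (disp u u' (base M u) x m i p) \<le> 0"
      by (auto simp: reach_def)
    note w = cross2_nvec[OF P good[OF uu]]
    have wp: "wid P u > 0" "wid P u' > 0" using good_pair_nonzero[OF good[OF uu]] P by (auto intro: wid_pos)
    \<comment> \<open>This linear form vanishes on the necklace vector, so progress along the
      virtual chain does not change it. It is nonnegative on the cone and equals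
      \<open>M * cross2 u u'\<close> at the apex, which forces \<open>x\<close> away from the origin
      linearly in \<open>M\<close>.\<close>
    define f where "f y = cross2 u y * wid P u' - cross2 u' y * wid P u" for y
    have f_le: "f y \<le> F (u, u') * norm y" for y
    proof -
      have "cross2 u y * wid P u' \<le> (norm u * norm y) * wid P u'"
        using cross2_bound[of u y] wp by (intro mult_right_mono) auto
      moreover have "- cross2 u' y * wid P u \<le> (norm u' * norm y) * wid P u"
        using cross2_bound[of u' y] wp by (intro mult_right_mono) auto
      ultimately show ?thesis by (simp add: f_def F_def algebra_simps)
    qed
    have "0 \<le> f (disp u u' (base M u) x m i p)"
      using p(2,3) wp by (simp add: f_def mult_nonpos_nonneg order_trans[of _ 0])
    also have "f (disp u u' (base M u) x m i p) = f (x + kap i *\<^sub>R (p - tail_vertex u u' i)) - M *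
      cross2 u u'"
      using wp cross2_swap[of u' u] by (simp add: f_def disp_def cross2_linear w base_def algebra_simps)
    also have "f (x + kap i *\<^sub>R (p - tail_vertex u u' i)) \<le> F (u, u') * norm (x + kap i *\<^sub>R (p -
      tail_vertex u u' i))" by (rule f_le)
    also have "\<dots> \<le> F (u, u') * (norm x + D)"
      using pos[OF uu] norm_triangle_ineq[of x "kap i *\<^sub>R (p - tail_vertex u u' i)"] D[OF p(1)
        tail_vertex_in[OF uu], of i i]
      by (intro mult_left_mono) auto
    finally have "M * E (u, u') \<le> norm x + D" using pos[OF uu] by (simp add: E_def field_simps)
    moreover have "e \<le> E (u, u')" unfolding e_def using fin uu by (intro Min_le) auto
    ultimately show ?thesis using mult_left_mono[of e "E (u, u')" M] \<open>M \<ge> 0\<close> by linarith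
  qed
  thus ?thesis using \<open>e > 0\<close> by blast
qed

text \<open>By \<open>rstar_nvec\<close> the two apexes differ by \<open>M * rstar P u u'\<close>
  necklace vectors. By \<open>lattice\<close> this is an integer number of periods, so
  \<open>reach_shift\<close> applies.\<close>

lemma reach_base_next:
  assumes uu: "(u, u') \<in> Prs" and M: "M = of_nat N * M0"
  shows "reach u u' (base M u') x m \<longleftrightarrow> reach u u' (base M u) x m"
proof -
  obtain T :: int where T: "M0 * rstar P u u' = of_int T * S" using lattice[OF uu] by blast
  have "base M u' = M *\<^sub>R ((1 / wid P u') *\<^sub>R u')" by (simp add: base_def)
  also have "\<dots> = base M u + (M * rstar P u u') *\<^sub>R nvec P u u'"
    unfolding rstar_nvec[OF P good[OF uu]] by (simp add: base_def algebra_simps)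
  also have "M * rstar P u u' = of_int (int N * T) * S" using T by (simp add: M)
  finally show ?thesis by (simp only: reach_shift)
qed

text \<open>The point \<open>x\<close> itself belongs to the virtual chain. It avoids the translated
  cones at both ends of the necklace side, which bounds its coordinates with respect to
  \<open>u\<close> and \<open>u'\<close>.\<close>

lemma not_reach_bounded:
  assumes uu: "(u, u') \<in> Prs" and M: "M = of_nat N * M0" and x: "x \<in> sector u u'"
    and nr: "\<not> reach u u' (base M u) x m"
  shows "norm x \<le> M * (norm u / wid P u + norm u' / wid P u')"
proof -
  have wp: "wid P u > 0" "wid P u' > 0" using good_pair_nonzero[OF good[OF uu]] P by (auto intro: wid_pos)
  have c: "cross2 u u' > 0" using good[OF uu] by (simp add: good_pair_def)
  have xs: "cross2 u x \<ge> 0" "cross2 u' x < 0" using x by (auto simp: sector_def)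
  have nr': "\<not> reach u u' (base M u') x m" using nr reach_base_next[OF uu M] by simp
  have "disp u u' q x m m (tail_vertex u u' m) = x - q" for q by (simp add: disp_def)
  hence n: "\<not> (cross2 u (x - q) \<ge> 0 \<and> cross2 u' (x - q) \<le> 0)" if "\<not> reach u u' q x m" for q
    using that tail_vertex_in[OF uu] unfolding reach_def by metis
  have 1: "cross2 x u' \<le> M * (cross2 u u' / wid P u)"
    using n[OF nr] xs cross2_swap[of u' u] cross2_swap[of x u'] by (auto simp: cross2_linear base_def)
  have 2: "cross2 u x \<le> M * (cross2 u u' / wid P u')"
    using n[OF nr'] xs by (auto simp: cross2_linear base_def)
  have "cross2 u u' * norm x = norm (cross2 x u' *\<^sub>R u + cross2 u x *\<^sub>R u')"
    using c by (simp flip: cross2_expand)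
  also have "\<dots> \<le> cross2 x u' * norm u + cross2 u x * norm u'"
    by (rule order_trans[OF norm_triangle_ineq]) (use xs cross2_swap[of x u'] in auto)
  also have "\<dots> \<le> M * (cross2 u u' / wid P u) * norm u + M * (cross2 u u' / wid P u') * norm u'"
    by (intro add_mono mult_right_mono 1 2) auto
  also have "\<dots> = cross2 u u' * (M * (norm u / wid P u + norm u' / wid P u'))" by (simp add: algebra_simps)
  finally show ?thesis using c by simp
qed

text \<open>The sector of \<open>b m\<close> is unique, so a single apex is tested. For large
  \<open>M\<close> this property is constant along the chain.\<close>

definition outside :: "real \<Rightarrow> int \<Rightarrow> bool" where
  "outside M m \<longleftrightarrow> (\<exists>u u'. (u, u') \<in> Prs \<and> b m \<in> sector u u' \<and> reach u u' (base M u) (b m) m)"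

lemma bounded_orbit: "bounded (range b)"
proof -
  obtain D where D0: "D \<ge> 0" and D: "\<And>i p p'. p \<in> P \<Longrightarrow> p' \<in> P
    \<Longrightarrow> norm (kap i *\<^sub>R (p - p')) \<le> D" using polygon_size by blast
  obtain e D' where e: "e > 0" and far: "\<And>M u u' x m. M \<ge> 0 \<Longrightarrow> (u, u') \<in> Prs
    \<Longrightarrow> reach u u' (base M u) x m \<Longrightarrow> norm x \<ge> M * e - D'"
    using reach_far by blast
  obtain R where R: "\<And>x y u u'. (u, u') \<in> Prs \<Longrightarrow> x \<in> sector u u'
    \<Longrightarrow> norm x \<ge> R \<Longrightarrow>
        norm (y - x) \<le> D \<Longrightarrow> cross2 x y \<ge> 0 \<Longrightarrow>
        y \<in> sector u u' \<or> (\<exists>u''. (u', u'') \<in> Prs \<and> y \<in> sector u' u'')"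
    using next_sector[of D] by blast
  \<comment> \<open>\<open>N\<close> is so large that outside positions have norm above
    \<open>\<bar>R\<bar> + D + norm (b 0)\<close>: then \<open>next_sector\<close> applies to a step
    as soon as one of its ends is outside, and \<open>b 0\<close> is not outside.\<close>
  obtain N :: nat where N: "of_nat N > (\<bar>R\<bar> + D + norm (b 0) + \<bar>D'\<bar>) / (M0 * e)"
    using reals_Archimedean2 by blast
  define M where "M = of_nat N * M0"
  have M_nonneg: "M \<ge> 0" using M0 by (simp add: M_def)
  have Me: "M * e - D' > \<bar>R\<bar> + D + norm (b 0)"
    using N M0 e by (simp add: M_def field_simps)
  have close: "norm (b (m + 1) - b m) \<le> D" for m
    using D[OF A_in A_in] by (simp add: b_Suc)
  have turn: "cross2 (b m) (b (m + 1)) \<ge> 0" for m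
  proof (cases "A (m + 1) = A m")
    case False
    from tail[OF A_in this] show ?thesis by (simp add: b_Suc cross2_linear)
  qed (simp add: b_Suc)
  have same: "outside M (m + 1) \<longleftrightarrow> outside M m" if big: "norm (b m) \<ge> R" for m
  proof -
    obtain u u' where uu: "(u, u') \<in> Prs" "b m \<in> sector u u'" using cover[OF b0] by blast
    have om: "outside M m \<longleftrightarrow> reach u u' (base M u) (b m) m"
      using uniq uu unfolding outside_def by blast
    from R[OF uu big close turn] show ?thesis
    proof (elim disjE exE conjE)
      assume b1: "b (m + 1) \<in> sector u u'"
      have "outside M (m + 1) \<longleftrightarrow> reach u u' (base M u) (b (m + 1)) (m + 1)"
        using uniq uu(1) b1 unfolding outside_def by blast
      thus ?thesis using reach_same_sector[OF uu(1,2) b1] om by simp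
    next
      fix u'' assume uu': "(u', u'') \<in> Prs" "b (m + 1) \<in> sector u' u''"
      \<comment> \<open>The apex \<open>base M u'\<close> lies on the ray being crossed, so the
        question can be carried across there and then moved back along the necklace side to
        \<open>base M u\<close>.\<close>
      have "outside M (m + 1) \<longleftrightarrow> reach u' u'' (base M u') (b (m + 1)) (m + 1)"
        using uniq uu' unfolding outside_def by blast
      also have "\<dots> \<longleftrightarrow> reach u u' (base M u') (b m) m"
        by (rule reach_across_ray[OF uu(1) uu'(1) uu(2) uu'(2)]) (simp add: base_def)
      also have "\<dots> \<longleftrightarrow> reach u u' (base M u) (b m) m" by (rule reach_base_next[OF uu(1) M_def])
      finally show ?thesis using om by simp
    qed
  qed
  have outside_big: "norm (b m) > \<bar>R\<bar> + D + norm (b 0)" if "outside M m" for m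
    using that far[OF M_nonneg] Me unfolding outside_def by fastforce
  have step: "outside M (m + 1) \<longleftrightarrow> outside M m" for m
  proof (cases "outside M m")
    case True
    thus ?thesis using outside_big[OF True] D0 norm_ge_zero[of "b 0"] abs_ge_self[of R]
      by (intro same) linarith
  next
    case False
    \<comment> \<open>The old position is at most \<open>D\<close> closer to the origin than the new
      one.\<close>
    have "norm (b m) \<ge> R" if "outside M (m + 1)"
      using outside_big[OF that] close[of m] norm_triangle_ineq2[of "b (m + 1)" "b m"] norm_ge_zero[of
        "b 0"] by linarith
    thus ?thesis using same[of m] False by blast
  qed
  have "\<not> outside M 0" using outside_big[of 0] D0 by auto
  have never: "\<not> outside M m" for m
  proof (induction m rule: int_induct[where k = 0])
    case (step2 m) thus ?case using step[of "m - 1"] by simp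
  qed (use \<open>\<not> outside M 0\<close> step in auto)
  define G where "G = (\<lambda>(u, u'). M * (norm u / wid P u + norm u' / wid P u'))"
  have "norm (b m) \<le> (\<Sum>x\<in>Prs. G x)" for m
  proof -
    obtain u u' where uu: "(u, u') \<in> Prs" "b m \<in> sector u u'" using cover[OF b0] by blast
    have "norm (b m) \<le> G (u, u')"
      using not_reach_bounded[OF uu(1) M_def uu(2)] never[of m] uu unfolding outside_def G_def by auto
    also have "\<dots> \<le> (\<Sum>x\<in>Prs. G x)"
    proof (rule member_le_sum[OF uu(1) _ fin])
      fix x assume "x \<in> Prs - {(u, u')}"
      then obtain v v' where x: "x = (v, v')" "(v, v') \<in> Prs" by (cases x) auto
      have "wid P v > 0" "wid P v' > 0" using good_pair_nonzero[OF good[OF x(2)]] P by (auto intro: wid_pos)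
      thus "G x \<ge> 0" using M_nonneg by (simp add: G_def x)
    qed
    finally show ?thesis .
  qed
  thus ?thesis by (auto simp: bounded_iff)
qed

end

section \<open>The rays parallel to the sides\<close>

lemma positive_combination_angle:
  assumes d: "0 < d" "d < pi" and st: "s > 0" "t > 0"
  obtains r \<phi> where "r > 0" "a < \<phi>" "\<phi> < a + d" "s *\<^sub>R cis a + t *\<^sub>R cis (a + d) = r *\<^sub>R cis \<phi>"
proof -
  \<comment> \<open>The combination turned back by \<open>a\<close>, so that \<open>Arg\<close>
    measures the angle from the first vector.\<close>
  define x where "x = s *\<^sub>R cis 0 + t *\<^sub>R cis d"
  have sd: "sin d > 0" using d by (rule sin_gt_zero)
  have "Im x > 0" using sd st by (simp add: x_def)
  hence x0: "x \<noteq> 0" and A: "0 < Arg x" "Arg x < pi" using Arg_lt_pi[of x] by auto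
  have xe: "x = norm x *\<^sub>R cis (Arg x)" by (metis rcis_cmod_Arg rcis_def scaleR_conv_of_real)
  have "cross2 x (cis d) = s * sin d" unfolding x_def cross2_add_left cross2_scaleR_left cross2_cis by simp
  moreover have "cross2 x (cis d) = norm x * sin (d - Arg x)"
    by (subst xe) (simp add: cross2_cis)
  ultimately have "norm x * sin (d - Arg x) > 0" using sd st by simp
  hence sp: "sin (d - Arg x) > 0" by (simp add: zero_less_mult_iff)
  have "Arg x < d"
  proof (rule ccontr)
    assume "\<not> Arg x < d"
    hence "sin (Arg x - d) \<ge> 0" using A d by (intro sin_ge_zero) auto
    thus False using sp sin_minus[of "Arg x - d"] by simp
  qed
  have "s *\<^sub>R cis a + t *\<^sub>R cis (a + d) = cis a * x"
    by (simp add: x_def algebra_simps cis_mult)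
  also have "\<dots> = norm x *\<^sub>R cis (a + Arg x)"
    by (subst xe) (simp add: cis_mult)
  finally show thesis using that[of "norm x" "a + Arg x"] A \<open>Arg x < d\<close> x0 by simp
qed

lemma cis_eq_cis_iff: "cis a = cis b \<longleftrightarrow> (\<exists>k::int. a = b + 2 * pi * of_int k)"
  using sin_cos_eq_iff[of a b] by (auto simp: complex_eq_iff)

lemma angle_in_window:
  obtains \<phi> where "c \<le> \<phi>" "\<phi> < c + 2 * pi" "cis \<phi> = cis a"
proof
  define k where "k = \<lceil>(c - a) / (2 * pi)\<rceil>"
  have 1: "(c - a) / (2 * pi) \<le> of_int k" "of_int k < (c - a) / (2 * pi) + 1" unfolding k_def by linarith+
  show "c \<le> a + 2 * pi * of_int k" "a + 2 * pi * of_int k < c + 2 * pi"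
    using 1 by (simp_all add: field_simps)
  show "cis (a + 2 * pi * of_int k) = cis a" by (auto simp: cis_eq_cis_iff)
qed

lemma angles_equal_in_window:
  assumes "cis a = cis b" "c \<le> a" "a < c + 2 * pi" "c \<le> b" "b < c + 2 * pi"
  shows "a = b"
proof -
  obtain k :: int where k: "a = b + 2 * pi * of_int k" using assms(1) by (auto simp: cis_eq_cis_iff)
  have "2 * pi * of_int k < 2 * pi * 1" "2 * pi * (- 1) < 2 * pi * of_int k" using k assms(2-) by linarith+
  moreover have "x < y" if "2 * pi * x < 2 * pi * y" for x y
    using that pi_gt_zero by (meson mult_less_cancel_left_pos zero_less_mult_iff zero_less_numeral)
  ultimately have "of_int k < (1 :: real)" "(- 1 :: real) < of_int k" by blast+
  hence "k = 0" by linarith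
  thus ?thesis using k by simp
qed

section \<open>Cones between consecutive side directions\<close>

locale labelled_rays =
  fixes P :: "complex set" and \<theta> :: "nat \<Rightarrow> real"
  assumes P: "convex_polygon P" and lab: "ray_labelling P \<theta>"
begin

abbreviation n :: nat where "n \<equiv> num_dirs P"
abbreviation u :: "nat \<Rightarrow> complex" where "u j \<equiv> cis (\<theta> j)"

lemma mono: "strict_mono \<theta>" and theta_period: "\<theta> (j + 2 * n) = \<theta> j + 2 * pi"
  and rays: "(\<Union>j\<in>{1..2 * n}. halfline 0 (u j)) = side_dirs P"
  using lab by (auto simp: ray_labelling_def side_dirs_def)

lemma n_pos: "n > 0"
  using theta_period[of 0] by (cases "n = 0") auto

lemma theta_shift: "\<theta> (j + 2 * n * q) = \<theta> j + 2 * pi * q"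
proof (induction q)
  case (Suc q)
  have "\<theta> (j + 2 * n * Suc q) = \<theta> (j + 2 * n * q) + 2 * pi"
    using theta_period[of "j + 2 * n * q"] by (simp add: algebra_simps)
  thus ?case using Suc by (simp add: algebra_simps)
qed simp

lemma u_shift: "u (j + 2 * n * q) = u j"
  unfolding theta_shift cis_eq_cis_iff by (intro exI[of _ "int q"]) simp

lemma u_period: "u (j + 2 * n) = u j"
  using u_shift[of j 1] by simp

lemma u_side_dirs: "u j \<in> side_dirs P"
proof -
  have *: "u i \<in> side_dirs P" if "i \<in> {1..2 * n}" for i
    unfolding rays[symmetric] using that by (auto simp: halfline_def intro!: bexI[of _ i] exI[of _ 1])
  show ?thesis
  proof (cases j)
    case 0
    thus ?thesis using *[of "2 * n"] u_period[of 0] n_pos by simp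
  next
    case (Suc i)
    have "u (Suc (i mod (2 * n)) + 2 * n * (i div (2 * n))) = u (Suc (i mod (2 * n)))" by (rule u_shift)
    moreover have "Suc (i mod (2 * n)) + 2 * n * (i div (2 * n)) = j" using Suc by simp
    moreover have "Suc (i mod (2 * n)) \<in> {1..2 * n}" using n_pos by (auto simp: Suc_le_eq)
    ultimately show ?thesis using * by metis
  qed
qed

text \<open>Full turns are index shifts by \<open>2 * n\<close>. The lower bound
  \<open>\<theta> 0\<close> keeps the index a natural number when the angle has to be turned
  back.\<close>

lemma side_dirs_index:
  assumes "cis \<phi> \<in> side_dirs P" "\<phi> \<ge> \<theta> 0"
  shows "\<exists>d. \<phi> = \<theta> d"
proof -
  obtain i t where t: "t \<ge> 0" "cis \<phi> = t *\<^sub>R u i"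
    using assms(1) unfolding rays[symmetric] by (auto simp: halfline_def)
  have "norm (cis \<phi>) = norm (t *\<^sub>R u i)" by (rule arg_cong[OF t(2)])
  hence "t = 1" using t(1) by simp
  then obtain k :: int where k: "\<phi> = \<theta> i + 2 * pi * of_int k" using t cis_eq_cis_iff by auto
  show ?thesis
  proof (cases "k \<ge> 0")
    case True
    thus ?thesis using k theta_shift[of i "nat k"] by (intro exI[of _ "i + 2 * n * nat k"]) simp
  next
    case False
    define q where "q = nat (- k)"
    have q: "of_int k = - real q" using False by (simp add: q_def)
    have "\<theta> (0 + 2 * n * q) \<le> \<theta> i" using assms(2) k unfolding theta_shift q by (simp add: algebra_simps)
    hence "2 * n * q \<le> i" using mono by (simp add: strict_mono_less_eq)
    thus ?thesis using k q theta_shift[of "i - 2 * n * q" q] by (intro exI[of _ "i - 2 * n * q"]) simp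
  qed
qed

lemma gap_no_side_dirs:
  assumes "\<theta> j < \<phi>" "\<phi> < \<theta> (j + 1)" "r > 0"
  shows "r *\<^sub>R cis \<phi> \<notin> side_dirs P"
proof
  assume "r *\<^sub>R cis \<phi> \<in> side_dirs P"
  from side_dirs_scaleR[OF this, of "1 / r"] have "cis \<phi> \<in> side_dirs P" using assms by simp
  moreover have "\<theta> 0 \<le> \<theta> j" using mono by (simp add: strict_mono_less_eq)
  ultimately obtain d where "\<phi> = \<theta> d" using side_dirs_index[of \<phi>] assms by auto
  thus False using assms mono by (simp add: strict_mono_less)
qed

lemma gap_pos: "\<theta> j < \<theta> (j + 1)"
  using mono by (simp add: strict_mono_less)

text \<open>In a gap of at least a half turn, the maximizer for the middle direction remains one for
  the two directions a quarter turn away. These are opposite, so one point would realize both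
  extremes and the width would be zero.\<close>

lemma gap_less_pi: "\<theta> (j + 1) < \<theta> j + pi"
proof (rule ccontr)
  assume neg: "\<not> ?thesis"
  define m where "m = (\<theta> j + \<theta> (j + 1)) / 2"
  have m: "\<theta> j < m" "m < \<theta> (j + 1)" "m + pi / 2 \<le> \<theta> (j + 1)" "\<theta> j \<le> m - pi / 2"
    using neg gap_pos[of j] by (auto simp: m_def field_simps)
  obtain v where v: "maximizes P (cis m) v" using maximizes_exists[OF P] by blast
  have turn: "\<exists>r \<phi>. r > 0 \<and> \<theta> j < \<phi> \<and> \<phi> < \<theta> (j + 1) \<and> (1 - t) *\<^sub>R cis m + t *\<^sub>R cis w = r *\<^sub>R cis \<phi>"
    if "0 \<le> t" "t < 1" and w: "w = m + pi / 2 \<or> w = m - pi / 2" for t w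
  proof (cases "t = 0")
    case True
    thus ?thesis using m by (intro exI[of _ 1] exI[of _ m]) simp
  next
    case False
    hence t: "t > 0" "1 - t > 0" using that by auto
    from w show ?thesis
    proof
      assume w: "w = m + pi / 2"
      obtain r \<phi> where "r > 0" "m < \<phi>" "\<phi> < m + pi / 2" "(1 - t) *\<^sub>R cis m + t *\<^sub>R cis (m + pi / 2)
        = r *\<^sub>R cis \<phi>"
        by (rule positive_combination_angle[of "pi / 2" "1 - t" t m]) (use t in auto)
      thus ?thesis using m unfolding w by (intro exI[of _ r] exI[of _ \<phi>]) auto
    next
      assume w: "w = m - pi / 2"
      obtain r \<phi> where "r > 0" "w < \<phi>" "\<phi> < w + pi / 2" "t *\<^sub>R cis w + (1 - t) *\<^sub>R cis (w + pi / 2)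
        = r *\<^sub>R cis \<phi>"
        by (rule positive_combination_angle[of "pi / 2" t "1 - t" w]) (use t in auto)
      thus ?thesis using m unfolding w by (intro exI[of _ r] exI[of _ \<phi>]) (auto simp: add.commute)
    qed
  qed
  have max: "maximizes P (cis w) v" if w: "w = m + pi / 2 \<or> w = m - pi / 2" for w
  proof (rule maximizes_rotate[OF P v])
    fix t :: real assume "0 \<le> t" "t < 1"
    from turn[OF this w] obtain r \<phi> where "r > 0" "\<theta> j < \<phi>" "\<phi> < \<theta> (j + 1)"
      and e: "(1 - t) *\<^sub>R cis m + t *\<^sub>R cis w = r *\<^sub>R cis \<phi>" by blast
    thus "(1 - t) *\<^sub>R cis m + t *\<^sub>R cis w \<notin> side_dirs P" "(1 - t) *\<^sub>R cis m + t *\<^sub>R cis w \<noteq> 0"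
      unfolding e using gap_no_side_dirs by auto
  qed
  have "cis (m - pi / 2) = - cis (m + pi / 2)"
    by (simp add: complex_eq_iff cos_add cos_diff sin_add sin_diff)
  hence "maximizes P (cis (m + pi / 2)) v" "maximizes P (- cis (m + pi / 2)) v"
    using max[of "m + pi / 2"] max[of "m - pi / 2"] by auto
  hence "wid P (cis (m + pi / 2)) = 0" by (simp add: wid_def maximizes_sup_cross)
  thus False using wid_pos[OF P, of "cis (m + pi / 2)"] by simp
qed

lemma good_pair_u: "good_pair P (u j) (u (j + 1))"
  unfolding good_pair_def
proof (intro conjI allI impI)
  show "cross2 (u j) (u (j + 1)) > 0"
    unfolding cross2_cis using gap_pos[of j] gap_less_pi[of j] by (intro sin_gt_zero) auto
  fix s t :: real assume st: "s > 0 \<and> t > 0"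
  obtain r \<phi> where r: "r > 0" "\<theta> j < \<phi>" "\<phi> < \<theta> j + (\<theta> (j + 1) - \<theta> j)"
    "s *\<^sub>R u j + t *\<^sub>R cis (\<theta> j + (\<theta> (j + 1) - \<theta> j)) = r *\<^sub>R cis \<phi>"
    by (rule positive_combination_angle[of "\<theta> (j + 1) - \<theta> j" s t "\<theta> j"])
       (use st gap_pos[of j] gap_less_pi[of j] in auto)
  thus "s *\<^sub>R u j + t *\<^sub>R u (j + 1) \<notin> side_dirs P" using gap_no_side_dirs[of j \<phi> r] by simp
qed

lemma sector_angle:
  assumes x: "x \<in> sector (u j) (u (j + 1))"
  obtains r \<phi> where "r > 0" "\<theta> j \<le> \<phi>" "\<phi> < \<theta> (j + 1)" "x = r *\<^sub>R cis \<phi>"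
proof -
  have c: "cross2 (u j) (u (j + 1)) > 0" using good_pair_u by (simp add: good_pair_def)
  obtain s t where st: "s \<ge> 0" "t \<ge> 0" "x = s *\<^sub>R u j + t *\<^sub>R u (j + 1)"
    using x by (auto intro: cone_coordinates[OF c, of x] simp: sector_def)
  have "s > 0" using x c st cross2_swap[of "u (j + 1)" "u j"]
    by (cases "s = 0") (auto simp: sector_def cross2_linear)
  show thesis
  proof (cases "t = 0")
    case True
    thus ?thesis using that[of s "\<theta> j"] st \<open>s > 0\<close> gap_pos by simp
  next
    case False
    obtain r \<phi> where r: "r > 0" "\<theta> j < \<phi>" "\<phi> < \<theta> j + (\<theta> (j + 1) - \<theta> j)"
      "s *\<^sub>R u j + t *\<^sub>R cis (\<theta> j + (\<theta> (j + 1) - \<theta> j)) = r *\<^sub>R cis \<phi>"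
      by (rule positive_combination_angle[of "\<theta> (j + 1) - \<theta> j" s t "\<theta> j"])
         (use st \<open>s > 0\<close> False gap_pos[of j] gap_less_pi[of j] in auto)
    thus ?thesis using that[of r \<phi>] st by simp
  qed
qed

lemma angle_sector:
  assumes "r > 0" "\<theta> j \<le> \<phi>" "\<phi> < \<theta> (j + 1)"
  shows "r *\<^sub>R cis \<phi> \<in> sector (u j) (u (j + 1))"
proof -
  have "sin (\<phi> - \<theta> j) \<ge> 0" using assms gap_less_pi[of j] by (intro sin_ge_zero) auto
  moreover have "sin (\<theta> (j + 1) - \<phi>) > 0" using assms gap_less_pi[of j] by (intro sin_gt_zero) auto
  ultimately show ?thesis using assms sin_minus[of "\<phi> - \<theta> (j + 1)"]
    by (auto simp: sector_def cross2_cis mult_less_0_iff)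
qed

text \<open>Storing directions instead of indices identifies indices that differ by a
  period.\<close>

definition Prs :: "(complex \<times> complex) set" where
  "Prs = (\<lambda>j. (u j, u (j + 1))) ` {1..2 * n}"

lemma Prs_good: "(v, v') \<in> Prs \<Longrightarrow> good_pair P v v'"
  using good_pair_u by (auto simp: Prs_def)

lemma index_of_angle:
  assumes "\<theta> 1 \<le> \<phi>" "\<phi> < \<theta> 1 + 2 * pi"
  obtains j where "j \<in> {1..2 * n}" "\<theta> j \<le> \<phi>" "\<phi> < \<theta> (j + 1)"
proof -
  have ex: "\<phi> < \<theta> (1 + 2 * n)" using assms theta_period[of 1] by simp
  define i where "i = (LEAST i. \<phi> < \<theta> i)"
  have i: "\<phi> < \<theta> i" "i \<le> 1 + 2 * n" unfolding i_def using ex by (auto intro: LeastI Least_le)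
  have "\<theta> 1 < \<theta> i" using i assms by linarith
  hence "1 < i" using mono by (simp add: strict_mono_less)
  hence "\<theta> (i - 1) \<le> \<phi>" using not_less_Least[of "i - 1" "\<lambda>i. \<phi> < \<theta> i"] unfolding i_def[symmetric] by auto
  moreover have "i - 1 + 1 = i" "i - 1 \<in> {1..2 * n}" using i \<open>1 < i\<close> by auto
  ultimately show ?thesis using that[of "i - 1"] i by metis
qed

lemma Prs_cover:
  assumes "x \<noteq> 0"
  shows "\<exists>v v'. (v, v') \<in> Prs \<and> x \<in> sector v v'"
proof -
  obtain \<phi> where \<phi>: "\<theta> 1 \<le> \<phi>" "\<phi> < \<theta> 1 + 2 * pi" "cis \<phi> = cis (Arg x)" using angle_in_window .
  obtain j where j: "j \<in> {1..2 * n}" "\<theta> j \<le> \<phi>" "\<phi> < \<theta> (j + 1)" using index_of_angle[OF \<phi>(1,2)] .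
  have "x = norm x *\<^sub>R cis \<phi>" unfolding \<phi> by (metis rcis_cmod_Arg rcis_def scaleR_conv_of_real)
  hence "x \<in> sector (u j) (u (j + 1))" using angle_sector[OF _ j(2,3), of "norm x"] assms by simp
  thus ?thesis using j(1) unfolding Prs_def by blast
qed

lemma theta_window:
  assumes "j \<in> {1..2 * n}" "\<theta> j \<le> \<phi>" "\<phi> < \<theta> (j + 1)"
  shows "\<theta> 1 \<le> \<phi>" "\<phi> < \<theta> 1 + 2 * pi"
proof -
  have "\<theta> 1 \<le> \<theta> j" "\<theta> (j + 1) \<le> \<theta> (1 + 2 * n)" using assms(1) mono by (auto simp: strict_mono_less_eq)
  thus "\<theta> 1 \<le> \<phi>" "\<phi> < \<theta> 1 + 2 * pi" using assms theta_period[of 1] by auto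
qed

lemma Prs_unique:
  assumes "(v, v') \<in> Prs" "(w, w') \<in> Prs" "x \<in> sector v v'" "x \<in> sector w w'"
  shows "v = w \<and> v' = w'"
proof -
  obtain i j where i: "i \<in> {1..2 * n}" "v = u i" "v' = u (i + 1)" and j: "j \<in> {1..2 * n}" "w = u j"
    "w' = u (j + 1)"
    using assms by (auto simp: Prs_def)
  obtain r \<phi> where r: "r > 0" "\<theta> i \<le> \<phi>" "\<phi> < \<theta> (i + 1)" "x = r *\<^sub>R cis \<phi>"
    using sector_angle assms(3) i by metis
  obtain r' \<phi>' where r': "r' > 0" "\<theta> j \<le> \<phi>'" "\<phi>' < \<theta> (j + 1)" "x = r' *\<^sub>R cis \<phi>'"
    using sector_angle assms(4) j by metis
  have "norm (r *\<^sub>R cis \<phi>) = norm (r' *\<^sub>R cis \<phi>')" by (metis r(4) r'(4))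
  hence "r = r'" using r r' by simp
  hence "cis \<phi> = cis \<phi>'" using r r' by simp
  hence "\<phi> = \<phi>'" using theta_window[OF i(1) r(2,3)] theta_window[OF j(1) r'(2,3)]
    by (intro angles_equal_in_window)
  hence "\<theta> i < \<theta> (j + 1)" "\<theta> j < \<theta> (i + 1)" using r r' by auto
  hence "i = j" using mono by (simp add: strict_mono_less)
  thus ?thesis using i j by simp
qed

lemma Prs_next: "j \<in> {1..2 * n} \<Longrightarrow> (u (j + 1), u (j + 2)) \<in> Prs"
proof (cases "j = 2 * n")
  case True
  have "(u (1 + 2 * n), u (2 + 2 * n)) = (u 1, u (1 + 1))" unfolding u_period by (simp add: numeral_2_eq_2)
  moreover have "(u 1, u (1 + 1)) \<in> Prs" unfolding Prs_def using n_pos by (intro imageI) auto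
  ultimately show ?thesis using True by (simp add: add.commute)
next
  case False
  assume "j \<in> {1..2 * n}"
  thus ?thesis using False unfolding Prs_def by (intro image_eqI[of _ _ "j + 1"]) auto
qed

text \<open>Far from the origin the quotient \<open>y / x\<close> is close to 1, so its argument is
  smaller than the least gap \<open>g\<close> between rays; the sign of the determinant makes the
  turn counterclockwise.\<close>

lemma next_sector:
  "\<exists>R. \<forall>x y v v'. (v, v') \<in> Prs \<longrightarrow> x \<in> sector v v' \<longrightarrow> norm x \<ge> R \<longrightarrow>
     norm (y - x) \<le> D \<longrightarrow> cross2 x y \<ge> 0 \<longrightarrow>
     y \<in> sector v v' \<or> (\<exists>v''. (v', v'') \<in> Prs \<and> y \<in> sector v' v'')"
proof -
  define g where "g = Min ((\<lambda>j. \<theta> (j + 1) - \<theta> j) ` {1..2 * n})"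
  have ne: "{1..2 * n} \<noteq> {}" using n_pos by auto
  have "g > 0" unfolding g_def using ne gap_pos by (subst Min_gr_iff) auto
  have g_le: "g \<le> \<theta> (j + 1) - \<theta> j" if "j \<in> {1..2 * n}" for j
    unfolding g_def using that by (intro Min_le) auto
  have g_le': "\<theta> (j + 1) + g \<le> \<theta> (j + 2)" if "j \<in> {1..2 * n}" for j
  proof (cases "j = 2 * n")
    case True
    have "\<theta> (1 + 2 * n) = \<theta> 1 + 2 * pi" "\<theta> (2 + 2 * n) = \<theta> 2 + 2 * pi" by (rule theta_period)+
    thus ?thesis using g_le[of 1] n_pos unfolding True by (simp add: add.commute numeral_2_eq_2)
  next
    case False
    thus ?thesis using g_le[of "j + 1"] that by simp
  qed
  have "isCont Arg 1" by (intro continuous_at_Arg) auto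
  then obtain e0 where e0: "e0 > 0" "\<And>q. dist q 1 < e0 \<Longrightarrow> dist (Arg q) (Arg 1) < g"
    using \<open>g > 0\<close> unfolding continuous_at_eps_delta by (metis)
  define e where "e = min e0 1"
  have e: "e > 0" "e \<le> e0" "e \<le> 1" using e0 by (auto simp: e_def)
  show ?thesis
  proof (intro exI[of _ "\<bar>D\<bar> / e + 1"] allI impI)
    fix x y v v'
    assume vv: "(v, v') \<in> Prs" and x: "x \<in> sector v v'" and big: "\<bar>D\<bar> / e + 1 \<le> norm x"
      and near: "norm (y - x) \<le> D" and cr: "cross2 x y \<ge> 0"
    obtain j where j: "j \<in> {1..2 * n}" "v = u j" "v' = u (j + 1)" using vv by (auto simp: Prs_def)
    obtain r \<phi> where r: "r > 0" "\<theta> j \<le> \<phi>" "\<phi> < \<theta> (j + 1)" "x = r *\<^sub>R cis \<phi>"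
      using sector_angle x j by metis
    have x0: "norm x > 0" "x \<noteq> 0" using r by auto
    define q where "q = y / x"
    have "q - 1 = (y - x) / x" using x0 by (simp add: q_def diff_divide_distrib)
    hence "norm (q - 1) = norm (y - x) / norm x" by (simp add: norm_divide)
    also have "\<dots> \<le> \<bar>D\<bar> / norm x" using near x0 by (intro divide_right_mono) auto
    also have "\<dots> < e" using big e x0 by (simp add: divide_simps mult.commute)
    finally have q1: "norm (q - 1) < e" .
    hence q0: "q \<noteq> 0" using e by auto
    have "Im q = cross2 x y / (norm x)\<^sup>2"
      by (simp add: q_def cross2_def Im_divide cmod_power2)
    hence "Im q \<ge> 0" using cr by simp
    hence A: "Arg q \<ge> 0" by (simp add: Arg_less_0)
    have "Arg q < g" using e0(2)[of q] q1 e by (simp add: dist_norm)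
    have "y = q * x" using x0 by (simp add: q_def)
    also have "\<dots> = (norm q * r) *\<^sub>R cis (\<phi> + Arg q)"
      by (subst (1) rcis_cmod_Arg[of q, symmetric]) (simp add: r rcis_def cis_mult scaleR_conv_of_real
        algebra_simps)
    finally have y: "y = (norm q * r) *\<^sub>R cis (\<phi> + Arg q)" .
    have pos: "norm q * r > 0" using q0 r by simp
    show "y \<in> sector v v' \<or> (\<exists>v''. (v', v'') \<in> Prs \<and> y \<in> sector v' v'')"
    proof (cases "\<phi> + Arg q < \<theta> (j + 1)")
      case True
      thus ?thesis using angle_sector[OF pos _ True] r A j y by auto
    next
      case False
      have "\<phi> + Arg q < \<theta> (j + 1 + 1)" using r \<open>Arg q < g\<close> g_le'[OF j(1)] by simp
      from angle_sector[OF pos _ this] False have "y \<in> sector (u (j + 1)) (u (j + 1 + 1))" using y by simp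
      thus ?thesis using Prs_next[OF j(1)] j by auto
    qed
  qed
qed

text \<open>The side directions are invariant under a half turn, so adding \<pi> sends the angle of
  index \<open>j\<close> to that of an index \<open>s j\<close>. No ray lies between consecutive
  ones, so \<open>s\<close> shifts all indices by a constant; applied twice it is a full turn, that
  is, \<open>2 * n\<close> indices.\<close>

lemma u_opposite: "u (j + n) = - u j"
proof -
  have ex: "\<exists>d. \<theta> j + pi = \<theta> d" for j
  proof (rule side_dirs_index)
    have "cis (\<theta> j + pi) = - u j" by (simp add: complex_eq_iff)
    thus "cis (\<theta> j + pi) \<in> side_dirs P" using u_side_dirs side_dirs_minus by metis
    have "\<theta> 0 \<le> \<theta> j" using mono by (simp add: strict_mono_less_eq)
    thus "\<theta> 0 \<le> \<theta> j + pi" using pi_gt_zero by linarith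
  qed
  then obtain s where s: "\<And>j. \<theta> j + pi = \<theta> (s j)" by metis
  have s_Suc: "s (Suc j) = Suc (s j)" for j
  proof -
    have "\<theta> (s j) < \<theta> (s (Suc j))" using gap_pos[of j] by (simp flip: s)
    hence "s j < s (Suc j)" using mono by (simp add: strict_mono_less)
    moreover have "\<not> Suc (s j) < s (Suc j)"
    proof
      assume "Suc (s j) < s (Suc j)"
      hence "\<theta> (s j) < \<theta> (Suc (s j))" "\<theta> (Suc (s j)) < \<theta> (s (Suc j))" using mono
        by (simp_all add: strict_mono_less)
      hence "\<theta> j < \<theta> (Suc (s j)) - pi" "\<theta> (Suc (s j)) - pi < \<theta> (j + 1)" using s[of j] s[of "Suc j"] by auto
      hence "1 *\<^sub>R cis (\<theta> (Suc (s j)) - pi) \<notin> side_dirs P" by (intro gap_no_side_dirs[of j]) auto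
      moreover have "cis (\<theta> (Suc (s j)) - pi) = - u (Suc (s j))" by (simp add: complex_eq_iff)
      ultimately show False using u_side_dirs side_dirs_minus by simp
    qed
    ultimately show ?thesis by simp
  qed
  have s_add: "s j = s 0 + j" for j by (induction j) (auto simp: s_Suc)
  have "\<theta> (s (s 0)) = \<theta> (0 + 2 * n)" using s[of 0] s[of "s 0"] theta_period[of 0] by simp
  hence "s (s 0) = 0 + 2 * n" using mono strict_mono_eq by blast
  hence "s 0 = n" using s_add[of "s 0"] by simp
  hence "\<theta> (j + n) = \<theta> j + pi" using s[of j] s_add[of j] by (simp add: add.commute)
  thus ?thesis by (simp add: complex_eq_iff)
qed

end

section \<open>Heads, tails and the necklace polygon\<close>

lemma cross2_rebase: "cross2 (B - z) (p - z) = cross2 (B - z) (p - B)"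
  using cross2_add_right[of "B - z" "p - B" "B - z"] by simp

text \<open>Strictness makes the ray through \<open>B\<close> meet \<open>Q\<close> in
  \<open>B\<close> alone. A second candidate \<open>C\<close> would give determinants of
  \<open>B - z\<close> and \<open>C - z\<close> that violate antisymmetry.\<close>

lemma head_eqI:
  assumes "z \<notin> Q" "B \<in> Q" and cr: "\<And>p. p \<in> Q \<Longrightarrow> p \<noteq> B
    \<Longrightarrow> cross2 (B - z) (p - z) < 0"
  shows "head Q z = B"
  unfolding head_def
proof (rule the_equality)
  have Bz: "B \<noteq> z" using assms by auto
  have "p = B" if "p \<in> halfline z (B - z)" "p \<in> Q" for p
    using cr[OF that(2)] that(1) by (force simp: halfline_def)
  moreover have "B \<in> halfline z (B - z)" unfolding halfline_def by (auto intro!: exI[of _ 1])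
  ultimately have "halfline z (B - z) \<inter> Q = {B}" using \<open>B \<in> Q\<close> by blast
  moreover have "cross2 (B - z) (p - z) \<le> 0" if "p \<in> Q" for p
    using cr[OF that] by (cases "p = B") auto
  ultimately show "\<exists>u. u \<noteq> 0 \<and> halfline z u \<inter> Q = {B} \<and> (\<forall>p\<in>Q. cross2 u (p - z) \<le> 0)"
    using Bz by (intro exI[of _ "B - z"]) auto
next
  fix C assume "\<exists>u. u \<noteq> 0 \<and> halfline z u \<inter> Q = {C} \<and> (\<forall>p\<in>Q. cross2 u (p - z) \<le> 0)"
  then obtain u where u: "halfline z u \<inter> Q = {C}" "\<And>p. p \<in> Q
    \<Longrightarrow> cross2 u (p - z) \<le> 0" by blast
  hence C: "C \<in> halfline z u" "C \<in> Q" by auto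
  then obtain t where t: "t \<ge> 0" "C = z + t *\<^sub>R u" by (auto simp: halfline_def)
  have "cross2 (C - z) (B - z) \<le> 0" using u(2)[OF \<open>B \<in> Q\<close>] t by (simp add: mult_nonneg_nonpos)
  thus "C = B" using cr[OF C(2)] cross2_swap[of "C - z" "B - z"] by auto
qed

lemma tail_eqI:
  assumes "z \<notin> Q" "B \<in> Q" and cr: "\<And>p. p \<in> Q \<Longrightarrow> p \<noteq> B
    \<Longrightarrow> cross2 (B - z) (p - z) > 0"
  shows "tail Q z = B"
  unfolding tail_def
proof (rule the_equality)
  have Bz: "B \<noteq> z" using assms by auto
  have "p = B" if "p \<in> halfline z (B - z)" "p \<in> Q" for p
    using cr[OF that(2)] that(1) by (force simp: halfline_def)
  moreover have "B \<in> halfline z (B - z)" unfolding halfline_def by (auto intro!: exI[of _ 1])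
  ultimately have "halfline z (B - z) \<inter> Q = {B}" using \<open>B \<in> Q\<close> by blast
  moreover have "cross2 (B - z) (p - z) \<ge> 0" if "p \<in> Q" for p
    using cr[OF that] by (cases "p = B") auto
  ultimately show "\<exists>u. u \<noteq> 0 \<and> halfline z u \<inter> Q = {B} \<and> (\<forall>p\<in>Q. cross2 u (p - z) \<ge> 0)"
    using Bz by (intro exI[of _ "B - z"]) auto
next
  fix C assume "\<exists>u. u \<noteq> 0 \<and> halfline z u \<inter> Q = {C} \<and> (\<forall>p\<in>Q. cross2 u (p - z) \<ge> 0)"
  then obtain u where u: "halfline z u \<inter> Q = {C}" "\<And>p. p \<in> Q
    \<Longrightarrow> cross2 u (p - z) \<ge> 0" by blast
  hence C: "C \<in> halfline z u" "C \<in> Q" by auto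
  then obtain t where t: "t \<ge> 0" "C = z + t *\<^sub>R u" by (auto simp: halfline_def)
  have "cross2 (C - z) (B - z) \<ge> 0" using u(2)[OF \<open>B \<in> Q\<close>] t by simp
  thus "C = B" using cr[OF C(2)] cross2_swap[of "C - z" "B - z"] by auto
qed

text \<open>The sign of \<open>e\<close> selects the side: positive for the head, negative for the
  tail. With \<open>w\<close> separating \<open>z\<close> from \<open>P\<close>, the function
  \<open>g\<close> is \<open>e\<close> times the tangent of the angle from \<open>w\<close> to
  \<open>p - z\<close>, and a point of the compact set \<open>P\<close> where it is largest supports
  \<open>P\<close>.\<close>

lemma support_point_exists:
  assumes P: "convex_polygon P" and z: "z \<notin> P"
  shows "\<exists>B\<in>P. \<forall>p\<in>P. e * cross2 (B - z) (p - z) \<le> 0"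
proof -
  have P': "convex P" "compact P" "P \<noteq> {}"
    using P by (auto simp: convex_polygon_def polytope_imp_convex polytope_imp_compact)
  obtain w d where w: "inner w z < d" "\<And>p. p \<in> P \<Longrightarrow> inner w p > d"
    using separating_hyperplane_closed_point[OF P'(1) compact_imp_closed[OF P'(2)] z] by blast
  have pos: "inner w (p - z) > 0" if "p \<in> P" for p using w(1) w(2)[OF that] by (simp add: inner_diff_right)
  define g where "g p = e * cross2 w (p - z) / inner w (p - z)" for p
  have "continuous_on P g" unfolding g_def cross2_eq_inner
    using pos by (intro continuous_intros) (force simp: less_le)
  then obtain B where B: "B \<in> P" "\<And>p. p \<in> P \<Longrightarrow> g p \<le> g B"
    using continuous_attains_sup[OF P'(2,3)] by blast
  have "e * cross2 (B - z) (p - z) \<le> 0" if p: "p \<in> P" for p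
  proof -
    have w0: "(norm w)\<^sup>2 > 0" using w(1) w(2)[OF p] by auto
    have gi: "e * cross2 w (q - z) = g q * inner w (q - z)" if "q \<in> P" for q
      using pos[OF that] by (simp add: g_def)
    have "(norm w)\<^sup>2 * cross2 (B - z) (p - z) = inner w (B - z) * cross2 w (p - z) - cross2 w (B - z) *
      inner w (p - z)"
      unfolding cmod_power2 inner_complex_def cross2_def by algebra
    hence "(norm w)\<^sup>2 * (e * cross2 (B - z) (p - z)) = inner w (B - z) * (e * cross2 w (p - z)) - (e *
      cross2 w (B - z)) * inner w (p - z)"
      by (metis (no_types, opaque_lifting) mult.assoc mult.commute right_diff_distrib)
    also have "\<dots> = inner w (B - z) * inner w (p - z) * (g p - g B)"
      unfolding gi[OF p] gi[OF B(1)] by (simp add: algebra_simps)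
    also have "\<dots> \<le> 0" using pos[OF p] pos[OF B(1)] B(2)[OF p] by (intro mult_nonneg_nonpos) auto
    finally show ?thesis using w0 by (simp add: mult_le_0_iff zero_less_mult_iff)
  qed
  thus ?thesis using B by blast
qed

text \<open>A tie gives, by \<open>edge_through\<close>, an edge containing \<open>B\<close> and
  \<open>p\<close>. Both are collinear with \<open>z\<close>, which would then lie on a side
  line.\<close>

lemma support_point_strict:
  assumes P: "convex_polygon P" and z: "z \<notin> P" "\<not> on_side_line P z" and e: "e \<noteq> 0"
    and B: "B \<in> P" "\<And>p. p \<in> P \<Longrightarrow> e * cross2 (B - z) (p - z) \<le> 0"
    and p: "p \<in> P" "p \<noteq> B"
  shows "e * cross2 (B - z) (p - z) < 0"
proof (rule ccontr)
  assume "\<not> ?thesis"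
  hence eq: "cross2 (B - z) (p - z) = 0" using B(2)[OF p(1)] e by auto
  have Bz: "B - z \<noteq> 0" using B z by auto
  have mB: "maximizes P (e *\<^sub>R (B - z)) B"
    unfolding maximizes_def cross2_scaleR_left
  proof (intro conjI ballI B(1))
    fix q assume "q \<in> P"
    from B(2)[OF this] show "e * cross2 (B - z) q \<le> e * cross2 (B - z) B"
      unfolding cross2_rebase[of B z] by (simp only: cross2_diff_right right_diff_distrib diff_le_0_iff_le)
  qed
  have eqB: "cross2 (B - z) (p - B) = 0" using eq unfolding cross2_rebase[of B z p] .
  obtain s where s: "s edge_of P" "B \<in> s" "p \<in> s"
    by (rule edge_through[OF P _ mB p]) (use e Bz eqB in \<open>auto simp: cross2_diff_right\<close>)
  obtain t where t: "p - B = t *\<^sub>R (B - z)" using cross2_zero_imp_scaleR[OF eqB Bz] by blast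
  have t0: "t \<noteq> 0" using t p by auto
  have "z = B - (1 / t) *\<^sub>R (p - B)" unfolding t using t0 by simp
  also have "\<dots> = (1 + 1 / t) *\<^sub>R B + (- (1 / t)) *\<^sub>R p" by (simp add: scaleR_left_distrib scaleR_diff_right)
  also have "\<dots> \<in> affine hull s" using s by (intro mem_affine) (auto simp: hull_inc)
  finally show False using z s by (auto simp: on_side_line_def)
qed

lemma head_contact:
  assumes P: "convex_polygon P" and z: "z \<notin> P" "\<not> on_side_line P z"
  shows "head P z \<in> P" "\<And>p. p \<in> P \<Longrightarrow> p \<noteq> head P z
    \<Longrightarrow> cross2 (head P z - z) (p - head P z) < 0"
proof -
  obtain B where B: "B \<in> P" "\<And>p. p \<in> P \<Longrightarrow> 1 * cross2 (B - z) (p - z) \<le> 0"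
    using support_point_exists[OF P z(1), of 1] by blast
  have s: "cross2 (B - z) (p - z) < 0" if "p \<in> P" "p \<noteq> B" for p
    using support_point_strict[OF P z _ B that] by simp
  hence "head P z = B" using head_eqI[OF z(1) B(1)] by blast
  thus "head P z \<in> P" "\<And>p. p \<in> P \<Longrightarrow> p \<noteq> head P z
    \<Longrightarrow> cross2 (head P z - z) (p - head P z) < 0"
    using B s cross2_rebase by auto
qed

lemma tail_contact:
  assumes P: "convex_polygon P" and z: "z \<notin> P" "\<not> on_side_line P z"
  shows "tail P z \<in> P" "\<And>p. p \<in> P \<Longrightarrow> p \<noteq> tail P z
    \<Longrightarrow> cross2 (tail P z - z) (p - tail P z) > 0"
proof -
  obtain B where B: "B \<in> P" "\<And>p. p \<in> P \<Longrightarrow> - 1 * cross2 (B - z) (p - z) \<le> 0"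
    using support_point_exists[OF P z(1), of "- 1"] by blast
  have s: "cross2 (B - z) (p - z) > 0" if "p \<in> P" "p \<noteq> B" for p
    using support_point_strict[OF P z _ B that] by simp
  hence "tail P z = B" using tail_eqI[OF z(1) B(1)] by blast
  thus "tail P z \<in> P" "\<And>p. p \<in> P \<Longrightarrow> p \<noteq> tail P z
    \<Longrightarrow> cross2 (tail P z - z) (p - tail P z) > 0"
    using B s cross2_rebase by auto
qed

section \<open>Necklace vectors and side ratios\<close>

context labelled_rays begin

lemma cone_between_eq:
  "cone_between \<theta> j = {x. cross2 (u j) x \<ge> 0 \<and> cross2 (u (j + 1)) x \<le> 0}"
proof (intro set_eqI iffI)
  fix x assume "x \<in> cone_between \<theta> j"
  then obtain t \<phi> where t: "x = t *\<^sub>R cis \<phi>" "t \<ge> 0" "\<theta> j \<le> \<phi>" "\<phi> \<le> \<theta> (j + 1)"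
    by (auto simp: cone_between_def)
  have "sin (\<phi> - \<theta> j) \<ge> 0" "sin (\<theta> (j + 1) - \<phi>) \<ge> 0"
    using t gap_less_pi[of j] by (auto intro!: sin_ge_zero)
  thus "x \<in> {x. cross2 (u j) x \<ge> 0 \<and> cross2 (u (j + 1)) x \<le> 0}"
    using t sin_minus[of "\<phi> - \<theta> (j + 1)"] by (auto simp: cross2_cis mult_nonneg_nonpos)
next
  fix x assume x: "x \<in> {x. cross2 (u j) x \<ge> 0 \<and> cross2 (u (j + 1)) x \<le> 0}"
  have c: "cross2 (u j) (u (j + 1)) > 0" using good_pair_u by (simp add: good_pair_def)
  show "x \<in> cone_between \<theta> j"
  proof (cases "cross2 (u (j + 1)) x = 0")
    case True
    obtain t where t: "x = t *\<^sub>R u (j + 1)" using cross2_zero_imp_scaleR[OF True] by auto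
    have "t \<ge> 0" using x c unfolding t by (simp add: zero_le_mult_iff)
    thus ?thesis using t gap_pos[of j] unfolding cone_between_def
      by (intro CollectI exI[of _ t] exI[of _ "\<theta> (j + 1)"]) auto
  next
    case False
    hence "x \<in> sector (u j) (u (j + 1))" using x by (auto simp: sector_def)
    from sector_angle[OF this] obtain r \<phi> where "r > 0" "\<theta> j \<le> \<phi>" "\<phi> < \<theta> (j + 1)" "x = r *\<^sub>R cis \<phi>" .
    thus ?thesis unfolding cone_between_def by (intro CollectI exI[of _ r] exI[of _ \<phi>]) auto
  qed
qed

lemma interior_cone_between:
  "interior (cone_between \<theta> j) = {x. cross2 (u j) x > 0 \<and> cross2 (u (j + 1)) x < 0}"
proof -
  have "cone_between \<theta> j = {x. inner (\<i> * u j) x \<ge> 0} \<inter> {x. inner (\<i> * u (j + 1)) x \<le> 0}"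
    unfolding cone_between_eq by (auto simp: cross2_eq_inner)
  thus ?thesis by (simp add: interior_halfspace_ge interior_halfspace_le) (auto simp: cross2_eq_inner)
qed

text \<open>\<open>k\<close> distinguishes translates of \<open>P\<close> from translates of its
  reflection. All points of \<open>Q\<close> have directions inside the cone, for which the same two
  vertices of \<open>P\<close> are extremal. Reflection exchanges these vertices and also reverses
  their difference, so the result is the same.\<close>

lemma head_in_cone:
  assumes k: "k = 1 \<or> k = -1" and Q: "Q = (\<lambda>p. t + k *\<^sub>R p) ` P" and int: "Q \<subseteq> interior (cone_between \<theta> j)"
  shows "head Q 0 - tail Q 0 = nvec P (u j) (u (j + 1))"
proof -
  note g = good_pair_u[of j]
  have c: "cross2 (u j) (u (j + 1)) > 0" using g by (simp add: good_pair_def)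
  have z: "0 \<notin> Q" using int unfolding interior_cone_between by auto
  have direction: "\<exists>a b. a > 0 \<and> b > 0 \<and> x = a *\<^sub>R u j + b *\<^sub>R u (j + 1)" if "x \<in> Q" for x
    using that int open_cone_coordinates[OF c, of x] unfolding interior_cone_between by blast
  \<comment> \<open>Treats both contacts at once: \<open>s = 1\<close> for the head,
    \<open>s = -1\<close> for the tail.\<close>
  have extreme: "\<And>p. p \<in> Q \<Longrightarrow> p \<noteq> t + k *\<^sub>R v
    \<Longrightarrow> s * cross2 (t + k *\<^sub>R v) (p - (t + k *\<^sub>R v)) < 0"
    if v: "v \<in> P" and s: "s = 1 \<or> s = -1"
      and m: "\<And>a b. a > 0 \<Longrightarrow> b > 0 \<Longrightarrow> maximizes P ((s * k) *\<^sub>R (a *\<^sub>R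
        u j + b *\<^sub>R u (j + 1))) v" for v s
  proof -
    fix p assume p: "p \<in> Q" "p \<noteq> t + k *\<^sub>R v"
    then obtain p' where p': "p' \<in> P" "p = t + k *\<^sub>R p'" "p' \<noteq> v" using Q by auto
    have BQ: "t + k *\<^sub>R v \<in> Q" using v Q by auto
    obtain a b where ab: "a > 0" "b > 0" "t + k *\<^sub>R v = a *\<^sub>R u j + b *\<^sub>R u (j + 1)"
      using direction[OF BQ] by blast
    have B: "t + k *\<^sub>R v \<notin> side_dirs P" "t + k *\<^sub>R v \<noteq> 0"
      using g ab BQ z by (auto simp: good_pair_def)
    have mB: "maximizes P ((s * k) *\<^sub>R (t + k *\<^sub>R v)) v" using m[OF ab(1,2)] ab(3) by simp
    have "(s * k) *\<^sub>R (t + k *\<^sub>R v) \<notin> side_dirs P"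
      using B side_dirs_minus[of "t + k *\<^sub>R v"] k s by (elim disjE) simp_all
    hence lt: "cross2 ((s * k) *\<^sub>R (t + k *\<^sub>R v)) p' < cross2 ((s * k) *\<^sub>R (t + k *\<^sub>R v)) v"
      using maximizes_unique[OF P _ _ mB p'(1)] p'(3) B k s by fastforce
    thus "s * cross2 (t + k *\<^sub>R v) (p - (t + k *\<^sub>R v)) < 0"
    proof -
      have d: "p - (t + k *\<^sub>R v) = k *\<^sub>R (p' - v)" by (simp add: p' scaleR_diff_right)
      show ?thesis
        using lt unfolding d cross2_scaleR_left cross2_scaleR_right cross2_diff_right
        by (simp only: right_diff_distrib mult.assoc mult.commute[of k] mult.left_commute[of k]
          diff_less_0_iff_less)
    qed
  qed
  define vh vt where "vh = (if k = 1 then vmax P (u j) (u (j + 1)) else vmin P (u j) (u (j + 1)))"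
    and "vt = (if k = 1 then vmin P (u j) (u (j + 1)) else vmax P (u j) (u (j + 1)))"
  have vP: "vh \<in> P" "vt \<in> P" using vmax_in[OF P g] vmin_in[OF P g] unfolding vh_def vt_def by presburger+
  have mh: "maximizes P ((1 * k) *\<^sub>R (a *\<^sub>R u j + b *\<^sub>R u (j + 1))) vh" if "a > 0" "b > 0" for a b
    using that k vmax_maximizes[OF P g, of a b] vmin_maximizes[OF P g, of a b] by (auto simp: vh_def)
  have 1: "head Q 0 = t + k *\<^sub>R vh"
  proof (rule head_eqI[OF z])
    fix p assume "p \<in> Q" "p \<noteq> t + k *\<^sub>R vh"
    with extreme[OF vP(1) _ mh, of p] have "cross2 (t + k *\<^sub>R vh) (p - (t + k *\<^sub>R vh)) < 0" by simp
    thus "cross2 (t + k *\<^sub>R vh - 0) (p - 0) < 0" unfolding cross2_rebase[of _ 0] by simp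
  qed (use Q vP in blast)
  have mt: "maximizes P ((- 1 * k) *\<^sub>R (a *\<^sub>R u j + b *\<^sub>R u (j + 1))) vt" if "a > 0" "b > 0" for a b
    using that k vmax_maximizes[OF P g, of a b] vmin_maximizes[OF P g, of a b]
      by (auto simp: vt_def add.commute)
  have 2: "tail Q 0 = t + k *\<^sub>R vt"
  proof (rule tail_eqI[OF z])
    fix p assume "p \<in> Q" "p \<noteq> t + k *\<^sub>R vt"
    hence "- 1 * cross2 (t + k *\<^sub>R vt) (p - (t + k *\<^sub>R vt)) < 0" using extreme[OF vP(2) _ mt] by blast
    hence "cross2 (t + k *\<^sub>R vt) (p - (t + k *\<^sub>R vt)) > 0" by linarith
    thus "cross2 (t + k *\<^sub>R vt - 0) (p - 0) > 0" unfolding cross2_rebase[of _ 0] by simp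
  qed (use Q vP in blast)
  show ?thesis using k unfolding 1 2 by (auto simp: vh_def vt_def nvec_def)
qed

lemma necklace_vec_eq: "necklace_vec P \<theta> j = nvec P (u j) (u (j + 1))"
  unfolding necklace_vec_def
proof (rule the_equality)
  have c: "cross2 (u j) (u (j + 1)) > 0" using good_pair_u by (simp add: good_pair_def)
  have "bounded P" using P by (simp add: convex_polygon_def polytope_imp_bounded)
  then obtain B where B: "\<And>p. p \<in> P \<Longrightarrow> norm p \<le> B" by (auto simp: bounded_iff)
  \<comment> \<open>Chosen so that the translation by \<open>t\<close> outweighs the size of
    \<open>P\<close> in both determinants that describe the cone.\<close>
  define N where "N = (\<bar>B\<bar> + 1) / cross2 (u j) (u (j + 1))"
  define t where "t = N *\<^sub>R (u j + u (j + 1))"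
  have N: "N * cross2 (u j) (u (j + 1)) = \<bar>B\<bar> + 1" using c by (simp add: N_def)
  have "(\<lambda>x. t + x) ` P \<subseteq> interior (cone_between \<theta> j)"
  proof clarify
    fix p assume "p \<in> P"
    hence "\<bar>cross2 (u j) p\<bar> \<le> \<bar>B\<bar>" "\<bar>cross2 (u (j + 1)) p\<bar> \<le> \<bar>B\<bar>"
      using cross2_bound[of "u j" p] cross2_bound[of "u (j + 1)" p] B[of p] by auto
    thus "t + p \<in> interior (cone_between \<theta> j)"
      unfolding interior_cone_between using N cross2_swap[of "u (j + 1)" "u j"]
      by (auto simp: t_def cross2_linear)
  qed
  moreover have "(\<lambda>x. t + x) ` P = (\<lambda>x. t + 1 *\<^sub>R x) ` P" by simp
  ultimately show "\<exists>Q t. (Q = (\<lambda>x. t + x) ` P \<or> Q = (\<lambda>x. t - x) ` P) \<and>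
      Q \<subseteq> interior (cone_between \<theta> j) \<and> nvec P (u j) (u (j + 1)) = head Q 0 - tail Q 0"
    using head_in_cone[of 1 "(\<lambda>x. t + x) ` P" t j] by metis
next
  fix a assume "\<exists>Q t. (Q = (\<lambda>x. t + x) ` P \<or> Q = (\<lambda>x. t - x) ` P) \<and>
      Q \<subseteq> interior (cone_between \<theta> j) \<and> a = head Q 0 - tail Q 0"
  then obtain Q t k where "k = 1 \<or> k = -1" "Q = (\<lambda>x. t + k *\<^sub>R x) ` P" "Q \<subseteq> interior (cone_between \<theta> j)"
    "a = head Q 0 - tail Q 0"
    by (force intro: that[of 1] that[of "-1"])
  thus "a = nvec P (u j) (u (j + 1))" using head_in_cone by simp
qed

text \<open>The determinant with the necklace vector is constant along a side, and on a ray it is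
  the coordinate times the width. This product therefore has the same value \<open>c\<close> at all
  vertices, which fixes the polygon up to scale.\<close>

lemma necklace_polygon_ratio:
  assumes "necklace_polygon P \<theta> A r"
  shows "\<exists>c>0. \<forall>j\<in>{1..2 * n}. r j = c * rstar P (u j) (u (j + 1))"
proof -
  have A1: "A 1 \<in> halfline 0 (u 1)" "A 1 \<noteq> 0"
    and ray: "\<And>j. j \<in> {1..2 * n} \<Longrightarrow> A (j + 1) \<in> halfline 0 (u (j + 1))"
    and side: "\<And>j. j \<in> {1..2 * n} \<Longrightarrow> A (j + 1) - A j = r j *\<^sub>R nvec P (u j) (u (j + 1))"
    using assms unfolding necklace_polygon_def necklace_vec_eq by blast+
  note w = cross2_nvec[OF P good_pair_u]
  have wp: "wid P (u j) > 0" for j by (rule wid_pos[OF P]) simp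
  obtain x1 where x1: "x1 \<ge> 0" "A 1 = x1 *\<^sub>R u 1" using A1 by (auto simp: halfline_def)
  have "x1 \<noteq> 0" using A1 x1 by auto
  define c where "c = x1 * wid P (u 1)"
  have c: "c > 0" using x1 \<open>x1 \<noteq> 0\<close> wp[of 1] by (simp add: c_def)
  have onray: "A j = (c / wid P (u j)) *\<^sub>R u j" if "j \<in> {1..2 * n + 1}" for j
    using that
  proof (induction j)
    case (Suc j)
    show ?case
    proof (cases "j = 0")
      case True
      thus ?thesis using x1 wp[of 1] by (simp add: c_def)
    next
      case False
      hence j: "j \<in> {1..2 * n}" "j \<in> {1..2 * n + 1}" using Suc.prems by auto
      note d = side[OF j(1)]
      obtain y where y: "A (j + 1) = y *\<^sub>R u (j + 1)" using ray[OF j(1)] by (auto simp: halfline_def)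
      have "cross2 (A (j + 1) - A j) (nvec P (u j) (u (j + 1))) = 0" unfolding d by simp
      hence "y * wid P (u (j + 1)) = c" using wp[of j]
        unfolding y Suc.IH[OF j(2)] cross2_diff_left cross2_scaleR_left w by simp
      hence "y = c / wid P (u (j + 1))" using wp[of "j + 1"] by (simp add: field_simps)
      thus ?thesis using y by simp
    qed
  qed simp
  have "r j = c * rstar P (u j) (u (j + 1))" if j: "j \<in> {1..2 * n}" for j
  proof -
    have "cross2 (u j) (A (j + 1) - A j) = r j * wid P (u j)" unfolding side[OF j] cross2_scaleR_right w ..
    moreover have "cross2 (u j) (A (j + 1) - A j) = c / wid P (u (j + 1)) * cross2 (u j) (u (j + 1))"
      using j by (subst onray[of j], simp, subst onray[of "j + 1"], simp) (simp add: cross2_diff_right)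
    ultimately show ?thesis using wp[of j] wp[of "j + 1"] by (simp add: rstar_def field_simps)
  qed
  thus ?thesis using c by blast
qed

text \<open>Quasi-rationality speaks of the first \<open>n\<close> ratios; this symmetry carries it
  to all \<open>2 * n\<close>.\<close>

lemma rstar_opposite: "rstar P (u (j + n)) (u (j + n + 1)) = rstar P (u j) (u (j + 1))"
proof -
  have e: "j + n + 1 = j + 1 + n" by simp
  show ?thesis unfolding e u_opposite by (simp only: rstar_def wid_minus cross2_minus_left
    cross2_minus_right minus_minus)
qed

lemma rational_multiples:
  assumes "necklace_polygon P \<theta> A r" "c > 0" "\<forall>j\<in>{1..n}. c * r j \<in> \<rat>"
  shows "\<exists>c>0. \<forall>(v, v')\<in>Prs. c * rstar P v v' \<in> \<rat>"
proof -
  obtain d where d: "d > 0" "\<And>j. j \<in> {1..2 * n} \<Longrightarrow> r j = d * rstar P (u j) (u (j + 1))"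
    using necklace_polygon_ratio[OF assms(1)] by blast
  have half: "c * d * rstar P (u j) (u (j + 1)) \<in> \<rat>" if "j \<in> {1..n}" for j
  proof -
    have "c * r j \<in> \<rat>" using assms(3) that by blast
    moreover have "c * r j = c * d * rstar P (u j) (u (j + 1))" using d(2)[of j] that
      by (simp only: mult.assoc) simp
    ultimately show ?thesis by metis
  qed
  have "c * d * rstar P (u j) (u (j + 1)) \<in> \<rat>" if j: "j \<in> {1..2 * n}" for j
  proof (cases "j \<le> n")
    case False
    hence "c * d * rstar P (u (j - n)) (u (j - n + 1)) \<in> \<rat>" using j by (intro half) auto
    thus ?thesis using rstar_opposite[of "j - n"] False by simp
  qed (use half j in auto)
  thus ?thesis using d(1) assms(2) by (intro exI[of _ "c * d"]) (auto simp: Prs_def)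
qed

end

lemma common_denominator:
  assumes "finite X" "\<And>x. x \<in> X \<Longrightarrow> f x \<in> \<rat>"
  shows "\<exists>d::nat. d > 0 \<and> (\<forall>x\<in>X. real d * f x \<in> \<int>)"
  using assms
proof (induction X)
  case (insert x X)
  then obtain d where d: "d > 0" "\<And>y. y \<in> X \<Longrightarrow> real d * f y \<in> \<int>" by auto
  obtain a b :: int where b: "b > 0" "f x = of_int a / of_int b"
    using insert.prems[of x] by (auto elim: Rats_cases')
  have bb: "real (nat b) = of_int b" using b by simp
  show ?case
  proof (intro exI[of _ "d * nat b"] conjI ballI)
    show "d * nat b > 0" using d b by simp
    fix y assume "y \<in> insert x X"
    thus "real (d * nat b) * f y \<in> \<int>"
    proof
      assume "y = x"
      hence "real (d * nat b) * f y = of_int (int d * a)" using b bb by simp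
      thus ?thesis by (metis Ints_of_int)
    next
      assume "y \<in> X"
      have "real (d * nat b) * f y = of_int b * (real d * f y)" using bb by simp
      thus ?thesis using d(2)[OF \<open>y \<in> X\<close>] by (metis Ints_mult Ints_of_int)
    qed
  qed
qed auto

section \<open>The moving polygon of a regular orbit\<close>

locale refractive_indices =
  fixes k :: nat and lam :: "nat \<Rightarrow> real"
  assumes k: "k \<ge> 1" and lam_pos: "\<And>i. i \<in> {1..k} \<Longrightarrow> lam i > 0" and lam_prod:
    "(\<Prod>i=1..k. lam i) = 1"
begin

abbreviation L :: "int \<Rightarrow> real" where "L \<equiv> refr_index k lam"

lemma L_pos: "L m > 0"
proof -
  have "nat ((m - 1) mod int k) < k" using k by (simp add: nat_less_iff)
  thus ?thesis unfolding refr_index_def by (intro lam_pos) auto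
qed

lemma L_shift: "L (m + int k) = L m"
  unfolding refr_index_def by (metis add_diff_eq diff_add_eq mod_add_self2)

lemma L_shift_mult: "L (m + q * (2 * int k)) = L m"
  unfolding refr_index_def
  by (metis (no_types, opaque_lifting) diff_add_eq mod_mult_self1 mult.assoc mult.commute)

lemma L_prod: "(\<Prod>l=1..2 * k. L (int l)) = 1"
proof -
  have "(\<Prod>l=1..k. L (int l)) = (\<Prod>l=1..k. lam l)"
  proof (rule prod.cong[OF refl])
    fix l assume l: "l \<in> {1..k}"
    hence "(int l - 1) mod int k = int l - 1" by (intro mod_pos_pos_trivial) auto
    thus "L (int l) = lam l" using l by (simp add: refr_index_def nat_diff_distrib)
  qed
  hence 1: "(\<Prod>l=1..k. L (int l)) = 1" using lam_prod by simp
  have "(\<Prod>l=1..2 * k. L (int l)) = (\<Prod>l=1..k. L (int l)) * (\<Prod>l=k + 1..k + k. L (int l))"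
    using prod.ub_add_nat[of 1 k "\<lambda>l. L (int l)" k] by (simp add: mult_2)
  also have "(\<Prod>l=k + 1..k + k. L (int l)) = (\<Prod>l=1..k. L (int (l + k)))"
    using prod.shift_bounds_cl_nat_ivl[of "\<lambda>l. L (int l)" 1 k k] by (simp add: add.commute)
  also have "\<dots> = (\<Prod>l=1..k. L (int l))" by (simp add: L_shift)
  finally show ?thesis using 1 by simp
qed

text \<open>Step \<open>l\<close> has linear part \<open>- L (int l)\<close>, and
  \<open>factor i\<close> inverts the product of the first \<open>i\<close> of these. At
  \<open>2 * k\<close> the number of signs is even and the product of the indices is 1.\<close>

definition factor :: "nat \<Rightarrow> real" where
  "factor i = (- 1) ^ i / (\<Prod>l=1..i. L (int l))"

lemma factor_0: "factor 0 = 1" and factor_Suc: "factor (Suc i) = - factor i / L (int (Suc i))"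
  and factor_period: "factor (2 * k) = 1"
  using L_prod by (simp_all add: factor_def)

lemma factor_nonzero: "factor i \<noteq> 0"
  by (simp add: factor_def less_imp_neq[OF L_pos, symmetric])

abbreviation K :: int where "K \<equiv> 2 * int k"

text \<open>\<open>kap m\<close> is the inverse of the linear part of the \<open>m\<close>-th iterate, and \<open>sg m\<close> sums the sizes
  \<open>\<bar>kap i\<bar>\<close> over \<open>i < m\<close>; doubling the period makes the sign periodic as well.\<close>

definition kap :: "int \<Rightarrow> real" where
  "kap m = factor (nat (m mod K))"

definition S :: real where
  "S = (\<Sum>i<2 * k. \<bar>factor i\<bar>)"

definition sg :: "int \<Rightarrow> real" where
  "sg m = of_int (m div K) * S + (\<Sum>i<nat (m mod K). \<bar>factor i\<bar>)"

lemma K_pos: "K > 0" using k by simp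

lemma kap_nonzero: "kap m \<noteq> 0"
  by (simp add: kap_def factor_nonzero)

lemma kap_period: "kap (m + K) = kap m"
  unfolding kap_def by simp

lemma sg_period: "sg (m + K) = sg m + S"
  unfolding sg_def using K_pos by (simp add: algebra_simps)

lemma S_pos: "S > 0"
  unfolding S_def using k factor_nonzero by (intro sum_pos) (auto simp: lessThan_empty_iff)

text \<open>Separates the two ways in which residue and quotient change from \<open>m\<close> to
  \<open>m + 1\<close>: within a period, or with a carry at its end.\<close>

lemma step_residue:
  obtains r where "m mod K = int r" "r < 2 * k" "L (m + 1) = L (int (Suc r))"
    "(Suc r < 2 * k \<and> (m + 1) mod K = int (Suc r) \<and> (m + 1) div K = m div K) \<or>
     (Suc r = 2 * k \<and> (m + 1) mod K = 0 \<and> (m + 1) div K = m div K + 1)"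
proof
  define r where "r = nat (m mod K)"
  have r: "int r = m mod K" using K_pos by (simp add: r_def)
  show "m mod K = int r" using r by simp
  have rK: "int r < K" unfolding r using K_pos by (rule pos_mod_bound)
  thus "r < 2 * k" by simp
  have m: "m = int r + (m div K) * K" unfolding r by (metis add.commute div_mult_mod_eq)
  hence "L (m + 1) = L (int (Suc r) + (m div K) * K)" by (metis add.assoc add.commute of_nat_Suc)
  thus "L (m + 1) = L (int (Suc r))" by (simp only: L_shift_mult)
  show "(Suc r < 2 * k \<and> (m + 1) mod K = int (Suc r) \<and> (m + 1) div K = m div K) \<or>
     (Suc r = 2 * k \<and> (m + 1) mod K = 0 \<and> (m + 1) div K = m div K + 1)"
  proof (cases "Suc r < 2 * k")
    case True
    have e: "m + 1 = int (Suc r) + (m div K) * K" using m by simp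
    have "int (Suc r) mod K = int (Suc r)" "int (Suc r) div K = 0" using True by auto
    thus ?thesis using True K_pos by (subst (1 2) e) (simp del: of_nat_Suc)
  next
    case False
    hence s: "Suc r = 2 * k" using rK by simp
    hence e: "m + 1 = (m div K + 1) * K" using m by (simp add: algebra_simps)
    have "(m + 1) mod K = 0" "(m + 1) div K = m div K + 1"
      using K_pos by (subst e, simp)+
    thus ?thesis using s by simp
  qed
qed

lemma kap_Suc: "kap (m + 1) = - kap m / L (m + 1)"
proof -
  obtain r where r: "m mod K = int r" "L (m + 1) = L (int (Suc r))"
    "(Suc r < 2 * k \<and> (m + 1) mod K = int (Suc r)) \<or> (Suc r = 2 * k \<and> (m + 1) mod K = 0)"
    using step_residue[of m] by metis
  have "factor (nat ((m + 1) mod K)) = factor (Suc r)"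
    using r(3) factor_0 factor_period by (elim disjE conjE) (simp_all only: nat_int nat_0)
  thus ?thesis unfolding kap_def r(1) r(2) factor_Suc by simp
qed

lemma sg_Suc: "sg (m + 1) = sg m + \<bar>kap m\<bar>"
proof -
  obtain r where r: "m mod K = int r"
    "(Suc r < 2 * k \<and> (m + 1) mod K = int (Suc r) \<and> (m + 1) div K = m div K) \<or>
     (Suc r = 2 * k \<and> (m + 1) mod K = 0 \<and> (m + 1) div K = m div K + 1)"
    using step_residue[of m] by metis
  have 1: "sg m + \<bar>kap m\<bar> = of_int (m div K) * S + (\<Sum>i<Suc r. \<bar>factor i\<bar>)"
    unfolding sg_def kap_def r(1) by simp
  from r(2) show ?thesis
  proof (elim disjE conjE)
    assume "(m + 1) mod K = int (Suc r)" "(m + 1) div K = m div K"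
    thus ?thesis unfolding 1 unfolding sg_def by (simp only: nat_int)
  next
    assume "Suc r = 2 * k" "(m + 1) mod K = 0" "(m + 1) div K = m div K + 1"
    thus ?thesis unfolding 1 unfolding sg_def by (simp add: S_def algebra_simps)
  qed
qed

lemma inverse_kap_bound: "\<exists>c. \<forall>m. 1 / \<bar>kap m\<bar> \<le> c"
proof (intro exI allI)
  fix m
  have "nat (m mod K) < 2 * k" using K_pos by (simp add: nat_less_iff)
  thus "1 / \<bar>kap m\<bar> \<le> (\<Sum>i<2 * k. 1 / \<bar>factor i\<bar>)"
    unfolding kap_def by (intro member_le_sum[of _ _ "\<lambda>i. 1 / \<bar>factor i\<bar>"]) auto
qed

end

section \<open>The orbit, its contact points and the chain of copies\<close>

locale regular_orbit = refractive_indices +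
  fixes P :: "complex set" and x :: complex
  assumes P: "convex_polygon P" and reg: "strongly_regular P k lam x"
begin

definition Z :: "int \<Rightarrow> complex" where
  "Z m = the (billiard P k lam m x)"

lemma billiard_Z: "billiard P k lam m x = Some (Z m)" and Z_side: "\<not> on_side_line P (Z m)"
  using reg unfolding strongly_regular_def Z_def by (metis option.sel)+

lemma iter_fwd_Z: "m \<ge> 0 \<Longrightarrow> iter_fwd P k lam x (nat m) = Some (Z m)"
  using billiard_Z[of m] by (simp add: billiard_def)

lemma iter_bwd_Z: "m \<le> 0 \<Longrightarrow> iter_bwd P k lam x (nat (- m)) = Some (Z m)"
  using billiard_Z[of m] by (cases "m = 0") (auto simp: billiard_def)

lemma fwd_step:
  assumes "m \<ge> 0" shows "step_fwd P (L (m + 1)) (Z m) = Some (Z (m + 1))"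
proof -
  have "nat (m + 1) = Suc (nat m)" using assms by simp
  moreover have "int (Suc (nat m)) = m + 1" using assms by simp
  ultimately show ?thesis using iter_fwd_Z[of "m + 1"] iter_fwd_Z[of m] assms by (simp add: add.commute)
qed

lemma bwd_step:
  assumes "m \<le> 0" shows "step_bwd P (L m) (Z m) = Some (Z (m - 1))"
proof -
  have "nat (- (m - 1)) = Suc (nat (- m))" using assms by simp
  moreover have "- int (nat (- m)) = m" using assms by simp
  ultimately show ?thesis using iter_bwd_Z[of "m - 1"] iter_bwd_Z[of m] assms by simp
qed

text \<open>Steps start only outside \<open>P\<close>, and from \<open>Z m\<close> the forward step
  is defined for \<open>m \<ge> 0\<close>, the backward step for \<open>m \<le> 0\<close>.\<close>

lemma Z_notin: "Z m \<notin> P"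
  using fwd_step[of m] bwd_step[of m]
  by (cases "m \<ge> 0") (auto simp: step_fwd_def step_bwd_def split: if_splits)

text \<open>The centre of the step from \<open>Z (m - 1)\<close> to \<open>Z m\<close>. For
  \<open>m \<le> 0\<close> the orbit is built backwards, and the centre is given as a tail about the
  later point.\<close>

definition A :: "int \<Rightarrow> complex" where
  "A m = (if m \<ge> 1 then head P (Z (m - 1)) else tail P (Z m))"

text \<open>For \<open>m \<le> 0\<close> the points \<open>Z (m - 1)\<close> and \<open>Z m\<close>
  lie on opposite sides of \<open>A m\<close>, so the tail property about one is the head property
  about the other. Both halves of the orbit thus obey the same relations.\<close>

lemma contact:
  shows A_in: "A m \<in> P"
    and Z_step: "Z m - A m = - L m *\<^sub>R (Z (m - 1) - A m)"
    and A_cross: "p \<in> P \<Longrightarrow> p \<noteq> A m \<Longrightarrow> cross2 (A m - Z (m - 1)) (p - A m) < 0"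
proof -
  have "A m \<in> P \<and> Z m - A m = - L m *\<^sub>R (Z (m - 1) - A m) \<and>
    (\<forall>p\<in>P. p \<noteq> A m \<longrightarrow> cross2 (A m - Z (m - 1)) (p - A m) < 0)"
  proof (cases "m \<ge> 1")
    case True
    note h = head_contact[OF P Z_notin[of "m - 1"] Z_side[of "m - 1"]]
    have "Z m = refl_scale (head P (Z (m - 1))) (L m) (Z (m - 1))"
      using fwd_step[of "m - 1"] True by (auto simp: step_fwd_def split: if_splits)
    hence "Z m - A m = - L m *\<^sub>R (Z (m - 1) - A m)"
      using True by (simp add: A_def refl_scale_def algebra_simps)
    thus ?thesis using h True by (simp add: A_def)
  next
    case False
    note h = tail_contact[OF P Z_notin[of m] Z_side[of m]]
    have "Z (m - 1) = refl_scale (tail P (Z m)) (1 / L m) (Z m)"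
      using bwd_step[of m] False by (auto simp: step_bwd_def split: if_splits)
    hence s: "Z (m - 1) - A m = (- (1 / L m)) *\<^sub>R (Z m - A m)"
      using False by (simp add: A_def refl_scale_def algebra_simps)
    have l: "L m > 0" by (rule L_pos)
    have "cross2 (A m - Z (m - 1)) (p - A m) < 0" if "p \<in> P" "p \<noteq> A m" for p
    proof -
      have "A m - Z (m - 1) = (- (1 / L m)) *\<^sub>R (A m - Z m)" using s by (simp add: algebra_simps)
      thus ?thesis using h(2)[of p] that False l by (simp add: A_def)
    qed
    thus ?thesis using h(1) False s l by (simp add: A_def)
  qed
  thus "A m \<in> P" "Z m - A m = - L m *\<^sub>R (Z (m - 1) - A m)"
    "p \<in> P \<Longrightarrow> p \<noteq> A m \<Longrightarrow> cross2 (A m - Z (m - 1)) (p - A m) < 0" by blast+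
qed

text \<open>Instead of the point, the polygon is moved: its \<open>m\<close>-th copy is \<open>kap m *\<^sub>R (P - Z m)\<close>, seen from the
  origin, and \<open>b m\<close> is where the copies \<open>m - 1\<close> and \<open>m\<close> touch.\<close>

definition b :: "int \<Rightarrow> complex" where
  "b m = kap m *\<^sub>R (A m - Z m)"

text \<open>Since \<open>kap (m + 1) * - L (m + 1)\<close> equals \<open>kap m\<close>, the contact
  point \<open>A (m + 1)\<close> has the same position in copy \<open>m\<close> as in copy
  \<open>m + 1\<close>: consecutive copies touch.\<close>

lemma b_Suc_head: "b (m + 1) = kap m *\<^sub>R (A (m + 1) - Z m)"
proof -
  have "A (m + 1) - Z (m + 1) = - L (m + 1) *\<^sub>R (A (m + 1) - Z m)"
    using Z_step[of "m + 1"] by (simp add: algebra_simps)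
  hence "b (m + 1) = (kap (m + 1) * - L (m + 1)) *\<^sub>R (A (m + 1) - Z m)" by (simp add: b_def)
  also have "kap (m + 1) * - L (m + 1) = kap m" using L_pos[of "m + 1"] by (simp add: kap_Suc)
  finally show ?thesis .
qed

lemma b_nonzero: "b m \<noteq> 0"
  using A_in[of m] Z_notin[of m] kap_nonzero[of m] by (auto simp: b_def)

text \<open>Passing from \<open>Z (m - 1)\<close> to \<open>Z m\<close> reverses the vector to
  \<open>A m\<close>, which turns the head inequality into the tail inequality; \<open>kap m\<close>
  enters squared, so its sign disappears.\<close>

lemma b_tail:
  assumes "p \<in> P" "p \<noteq> A m" shows "cross2 (b m) (kap m *\<^sub>R (p - A m)) > 0"
proof -
  have "A m - Z m = - L m *\<^sub>R (A m - Z (m - 1))" using Z_step[of m] by (simp add: algebra_simps)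
  hence "cross2 (b m) (kap m *\<^sub>R (p - A m)) = - ((kap m)\<^sup>2 * L m * cross2 (A m - Z (m - 1)) (p - A m))"
    by (simp add: b_def power2_eq_square)
  moreover have "(kap m)\<^sup>2 * L m > 0" using L_pos[of m] kap_nonzero[of m] by simp
  ultimately show ?thesis using A_cross[OF assms] by (simp add: mult_less_0_iff)
qed

lemma b_head:
  assumes "p \<in> P" "p \<noteq> A (m + 1)" shows "cross2 (b (m + 1)) (kap m *\<^sub>R (p - A (m + 1))) < 0"
proof -
  have "cross2 (b (m + 1)) (kap m *\<^sub>R (p - A (m + 1))) = (kap m)\<^sup>2 * cross2 (A (m + 1) - Z m) (p - A (m
    + 1))"
    by (simp add: b_Suc_head power2_eq_square)
  moreover have "(kap m)\<^sup>2 > 0" using kap_nonzero[of m] by simp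
  ultimately show ?thesis using A_cross[OF assms] by (simp add: mult_less_0_iff)
qed

text \<open>\<open>Z m\<close> differs from the contact point \<open>A m\<close> by
  \<open>(1 / kap m) *\<^sub>R b m\<close>, and periodicity bounds the factor.\<close>

lemma bounded_of_bounded_b:
  assumes "bounded (range b)"
  shows "bounded (billiard_orbit P k lam x)"
proof -
  obtain B where B: "\<And>m. norm (b m) \<le> B" using assms by (auto simp: bounded_iff)
  have "bounded P" using P by (simp add: convex_polygon_def polytope_imp_bounded)
  then obtain B' where B': "\<And>p. p \<in> P \<Longrightarrow> norm p \<le> B'" by (auto simp: bounded_iff)
  obtain c where c: "\<And>m. 1 / \<bar>kap m\<bar> \<le> c" using inverse_kap_bound by blast
  have "norm (Z m) \<le> B' + c * B" for m
  proof -
    have "Z m = A m - (1 / kap m) *\<^sub>R b m" using kap_nonzero[of m] by (simp add: b_def)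
    hence "norm (Z m) \<le> norm (A m) + norm ((1 / kap m) *\<^sub>R b m)" using norm_triangle_ineq4 by metis
    also have "norm ((1 / kap m) *\<^sub>R b m) = 1 / \<bar>kap m\<bar> * norm (b m)" by simp
    also have "\<dots> \<le> c * B" using c[of m] B[of m]
      by (intro mult_mono) (auto intro: order_trans[OF _ c[of m]])
    finally show ?thesis using B'[OF A_in[of m]] by simp
  qed
  moreover have "billiard_orbit P k lam x = range Z"
    by (auto simp: billiard_orbit_def billiard_Z)
  ultimately show ?thesis by (auto simp: bounded_iff)
qed

end

section \<open>Boundedness of regular orbits for quasi-rational polygons\<close>

theorem theorem1:
  fixes P :: "complex set" and k :: nat and lam :: "nat \<Rightarrow> real"
  assumes "convex_polygon P"
    and "k \<ge> 1"
    and "\<And>i. i \<in> {1..k} \<Longrightarrow> lam i > 0"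
    and "(\<Prod>i=1..k. lam i) = 1"
    and "quasi_rational P"
  shows "\<forall>x. strongly_regular P k lam x \<longrightarrow> bounded (billiard_orbit P k lam x)"
proof (intro allI impI)
  fix x assume "strongly_regular P k lam x"
  then interpret regular_orbit k lam P x by unfold_locales (use assms in auto)
  obtain \<theta> N r c where q: "ray_labelling P \<theta>" "necklace_polygon P \<theta> N r" "c > 0"
    "\<forall>j\<in>{1..num_dirs P}. c * r j \<in> \<rat>"
    using assms(5) unfolding quasi_rational_def by blast
  interpret R: labelled_rays P \<theta> by unfold_locales (use assms q in auto)
  have finite: "finite R.Prs" by (simp add: R.Prs_def)
  obtain d where d: "d > 0" "\<And>v v'. (v, v') \<in> R.Prs \<Longrightarrow> d * rstar P v v' \<in> \<rat>"
    using R.rational_multiples[OF q(2-4)] by auto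
  define f where "f y = d * rstar P (fst y) (snd y)" for y
  have f: "f y \<in> \<rat>" if "y \<in> R.Prs" for y
    using d(2)[of "fst y" "snd y"] that by (simp add: f_def)
  have "\<exists>h::nat. h > 0 \<and> (\<forall>y\<in>R.Prs. real h * f y \<in> \<int>)"
    by (rule common_denominator[OF finite f])
  then obtain h :: nat where h: "h > 0" and h': "\<forall>y\<in>R.Prs. real h * f y \<in> \<int>" by (elim exE conjE)
  \<comment> \<open>\<open>d\<close> makes all side ratios rational, \<open>h\<close> clears their
    denominators, and the factor \<open>S\<close> turns the resulting integers into whole periods of
    the chain.\<close>
  interpret necklace_orbit_sectors P R.Prs kap A b sg K S "real h * d * S"
  proof unfold_locales
    show "\<exists>T::int. real h * d * S * rstar P v v' = of_int T * S" if vv: "(v, v') \<in> R.Prs" for v v'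
    proof -
      obtain T where "real h * (d * rstar P v v') = of_int T" using bspec[OF h' vv]
        by (auto simp: f_def elim: Ints_cases)
      hence "real h * d * S * rstar P v v' = of_int T * S" by (simp add: mult.assoc mult.left_commute)
      thus ?thesis by blast
    qed
    show "b (m + 1) = b m + kap m *\<^sub>R (A (m + 1) - A m)" for m
      unfolding b_Suc_head by (simp add: b_def algebra_simps)
    show "real h * d * S > 0" using h d(1) S_pos by simp
  qed (fact P finite kap_nonzero A_in b_tail b_head kap_period sg_Suc sg_period K_pos b_nonzero
        R.Prs_good R.Prs_cover R.Prs_unique R.next_sector)+
  show "bounded (billiard_orbit P k lam x)" by (rule bounded_of_bounded_b[OF bounded_orbit])
qed

end
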